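(* Let $\mathcal H$ be a finite-dimensional Hilbert space and let $\mathcal T\subset\mathcal S(\mathcal H)$ be a set of quantum states. Then there exists an entanglement breaking channel $\Lambda:\mathcal L(\mathcal H)\to\mathcal L(\mathcal H)$ such that $\mathcal T\subset\mathrm{Fix}(\Lambda)$ if and only if the triple $(\mathcal T,\mathcal O(\mathcal H),\mathcal O(\mathcal H))$ is broadcastable.
   Context: $\mathcal S(\mathcal H)$ denotes the set of density operators on $\mathcal H$, and $\mathcal O(\mathcal H)$ the set of all observables (POVMs) $\{A_k\}_k$ on $\mathcal H$ (finitely many positive operators with $\sum_k A_k=I$). A channel is a completely positive trace-preserving linear map. An entanglement breaking (measure-and-prepare) channel is one of the form $\Lambda(\rho)=\sum_\lambda \mathrm{tr}[\rho G_\lambda]\sigma_\lambda$ with $\{G_\lambda\}_\lambda$ a POVM and $\sigma_\lambda$ states (finite index set). $\mathrm{Fix}(\Lambda)=\{\rho\in\mathcal S(\mathcal H):\Lambda(\rho)=\rho\}$. For a set of states $\mathcal T$ and sets of observables $\mathcal A,\mathcal B$, the triple $(\mathcal T,\mathcal A,\mathcal B)$ is broadcastable if there is a channel $\Lambda:\mathcal L(\mathcal H)\to\mathcal L(\mathcal H\otimes\mathcal H)$ with $\mathrm{tr}[A_k\,\mathrm{tr}_2\Lambda(\rho)]=\mathrm{tr}[A_k\rho]$ and $\mathrm{tr}[B_k\,\mathrm{tr}_1\Lambda(\rho)]=\mathrm{tr}[B_k\rho]$ for all $\{A_k\}\in\mathcal A$, $\{B_k\}\in\mathcal B$, $\rho\in\mathcal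 T$ and all $k$, where $\mathrm{tr}_i$ is the partial trace over subsystem $i$. *)

theory Defs
  imports "HOL-Analysis.Analysis"
begin

text \<open>Finite-dimensional Hilbert space H = complex^'n (any finite type 'n);
operators on H are complex^'n^'n; H \<otimes> H is indexed by the product type 'n \<times> 'n
(first component = first tensor factor).\<close>

definition psd_on :: "'i set \<Rightarrow> ('i \<Rightarrow> 'i \<Rightarrow> complex) \<Rightarrow> bool" where
  "psd_on I M \<longleftrightarrow> (\<forall>v :: 'i \<Rightarrow> complex.
     let q = (\<Sum>i\<in>I. \<Sum>j\<in>I. cnj (v i) * M i j * v j) in Im q = 0 \<and> Re q \<ge> 0)"

definition psd :: "complex^'a^'a \<Rightarrow> bool" where
  "psd A \<longleftrightarrow> psd_on (UNIV :: 'a::finite set) (\<lambda>i j. A $ i $ j)"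

definition cscale :: "complex \<Rightarrow> complex^'a^'a \<Rightarrow> complex^'a^'a" where
  "cscale c X = (\<chi> i j. c * X $ i $ j)"

definition states :: "(complex^'a^'a) set" where
  "states = {\<rho>. psd \<rho> \<and> trace \<rho> = 1}"

definition observables :: "(complex^'a^'a) list set" where
  "observables = {As. (\<forall>A\<in>set As. psd A) \<and> sum_list As = mat 1}"

text \<open>Complete positivity: \<Lambda> \<otimes> id_k is positive for every ancilla dimension k.
Operators on H \<otimes> C^k are represented as functions on the index set UNIV \<times> {..<k}.\<close>
definition completely_positive :: "(complex^'a::finite^'a \<Rightarrow> complex^'b::finite^'b) \<Rightarrow> bool" where
  "completely_positive \<Lambda> \<longleftrightarrow> (\<forall>k::nat. \<forall>X :: ('a \<times> nat) \<Rightarrow> ('a \<times> nat) \<Rightarrow> complex.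
     psd_on (UNIV \<times> {..<k}) X \<longrightarrow>
     psd_on ((UNIV :: 'b set) \<times> {..<k})
       (\<lambda>(p, a) (q, b). \<Lambda> (\<chi> i j. X (i, a) (j, b)) $ p $ q))"

definition channel :: "(complex^'a^'a \<Rightarrow> complex^'b^'b) \<Rightarrow> bool" where
  "channel \<Lambda> \<longleftrightarrow>
     (\<forall>X Y. \<Lambda> (X + Y) = \<Lambda> X + \<Lambda> Y) \<and>
     (\<forall>c X. \<Lambda> (cscale c X) = cscale c (\<Lambda> X)) \<and>
     completely_positive \<Lambda> \<and>
     (\<forall>X. trace (\<Lambda> X) = trace X)"

definition entanglement_breaking :: "(complex^'a^'a \<Rightarrow> complex^'b^'b) \<Rightarrow> bool" where
  "entanglement_breaking \<Lambda> \<longleftrightarrow> (\<exists>Gs (\<sigma>s :: (complex^'b^'b) list).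
     length Gs = length \<sigma>s \<and> Gs \<in> observables \<and> set \<sigma>s \<subseteq> states \<and>
     (\<forall>\<rho>. \<Lambda> \<rho> = sum_list (map2 (\<lambda>G \<sigma>. cscale (trace (\<rho> ** G)) \<sigma>) Gs \<sigma>s)))"

definition Fix :: "(complex^'a^'a \<Rightarrow> complex^'a^'a) \<Rightarrow> (complex^'a^'a) set" where
  "Fix \<Lambda> = {\<rho> \<in> states. \<Lambda> \<rho> = \<rho>}"

definition ptrace2 :: "complex^('a::finite \<times> 'b::finite)^('a \<times> 'b) \<Rightarrow> complex^'a^'a" where
  "ptrace2 X = (\<chi> i j. \<Sum>k\<in>(UNIV :: 'b set). X $ (i, k) $ (j, k))"

definition ptrace1 :: "complex^('a::finite \<times> 'b::finite)^('a \<times> 'b) \<Rightarrow> complex^'b^'b" where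
  "ptrace1 X = (\<chi> i j. \<Sum>k\<in>(UNIV :: 'a set). X $ (k, i) $ (k, j))"

definition broadcastable ::
  "(complex^'a^'a) set \<Rightarrow> (complex^'a^'a) list set \<Rightarrow> (complex^'a^'a) list set \<Rightarrow> bool" where
  "broadcastable T \<A> \<B> \<longleftrightarrow> (\<exists>\<Lambda> :: complex^'a^'a \<Rightarrow> complex^('a \<times> 'a)^('a \<times> 'a).
     channel \<Lambda> \<and>
     (\<forall>As\<in>\<A>. \<forall>\<rho>\<in>T. \<forall>k<length As.
        trace ((As ! k) ** ptrace2 (\<Lambda> \<rho>)) = trace ((As ! k) ** \<rho>)) \<and>
     (\<forall>Bs\<in>\<B>. \<forall>\<rho>\<in>T. \<forall>k<length Bs.
        trace ((Bs ! k) ** ptrace1 (\<Lambda> \<rho>)) = trace ((Bs ! k) ** \<rho>)))"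

end

theory Submission
  imports Defs
begin

text \<open>
  If \<open>L\<close> broadcasts \<open>T\<close>, let \<open>E\<close> be the average of its two marginals and \<open>P\<close> the Cesaro limit of the
  powers of \<open>E\<close>, a positive trace-preserving projection onto the fixed points of \<open>E\<close>. For a vector \<open>a\<close>,
  contracting one output of \<open>L \<omega>\<close> with \<open>a a\<^sup>*\<close> and applying \<open>P\<close> to the other gives a positive fixed
  point of \<open>E\<close> dominated by a multiple of \<open>\<omega>\<close>; if \<open>\<omega>\<close> is an extreme fixed state it therefore equals
  \<open>\<langle>a|\<omega>|a\<rangle> \<omega>\<close>. The extreme fixed states are thus joint eigenvectors of linear maps with distinct
  eigenvalue families, hence linearly independent, and by Krein-Milman the fixed states form a simplex.
  The barycentric coordinates of \<open>P \<rho>\<close> are positive linear functionals of \<open>\<rho>\<close>, that is, a POVM, and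
  measuring it and preparing the corresponding vertex fixes every state of \<open>T\<close>.

  Conversely, a measure-and-prepare channel is turned into a broadcasting one by preparing
  \<open>\<sigma> \<otimes> \<sigma>\<close> instead of \<open>\<sigma>\<close>.
\<close>

subsection \<open>Quadratic forms and positive matrices\<close>

definition qf :: "complex^'a^'a \<Rightarrow> ('a::finite \<Rightarrow> complex) \<Rightarrow> complex" where
  "qf M v = (\<Sum>i\<in>UNIV. \<Sum>j\<in>UNIV. cnj (v i) * M $ i $ j * v j)"

definition outer :: "('a \<Rightarrow> complex) \<Rightarrow> complex^'a^'a" where
  "outer a = (\<chi> i j. a i * cnj (a j))"

definition sqnorm :: "('a::finite \<Rightarrow> complex) \<Rightarrow> real" where
  "sqnorm a = (\<Sum>k\<in>UNIV. (cmod (a k))\<^sup>2)"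

lemma sqnorm_nonneg: "0 \<le> sqnorm a"
  by (simp add: sqnorm_def sum_nonneg)

lemma psd_iff: "psd M \<longleftrightarrow> (\<forall>v. qf M v \<in> \<real>\<^sub>\<ge>\<^sub>0)"
  by (auto simp: psd_def psd_on_def qf_def Let_def complex_nonneg_Reals_iff)

lemma qf_add: "qf (M + N) v = qf M v + qf N v"
  by (simp add: qf_def algebra_simps sum.distrib)

lemma qf_diff: "qf (M - N) v = qf M v - qf N v"
  by (simp add: qf_def algebra_simps sum_subtractf)

lemma qf_0 [simp]: "qf 0 v = 0"
  by (simp add: qf_def)

lemma qf_scaleR: "qf (r *\<^sub>R M) v = r *\<^sub>R qf M v"
  by (simp add: qf_def scaleR_sum_right)

lemma qf_sum: "qf (sum f A) v = (\<Sum>x\<in>A. qf (f x) v)"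
  by (induction A rule: infinite_finite_induct) (auto simp: qf_add)

lemma qf_mat_1: "qf (mat 1) v = of_real (sqnorm v)"
proof -
  have "qf (mat 1) v = (\<Sum>i\<in>UNIV. \<Sum>j\<in>UNIV. if i = j then cnj (v i) * v i else 0)"
    unfolding qf_def by (intro sum.cong refl) (auto simp: mat_def)
  also have "\<dots> = of_real (sqnorm v)"
    by (simp add: sqnorm_def complex_norm_square mult.commute del: of_real_power)
  finally show ?thesis .
qed

lemma qf_outer: "qf (outer a) v = of_real ((cmod (\<Sum>i\<in>UNIV. cnj (v i) * a i))\<^sup>2)"
  unfolding complex_norm_square qf_def outer_def cnj_sum sum_product
  by (intro sum.cong refl) (simp add: mult_ac)

text \<open>Vectors supported on at most two coordinates (\<open>k = l\<close> is allowed) are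
  enough to isolate single entries. The entrywise facts about positive matrices come from suitable
  choices of \<open>x\<close> and \<open>y\<close>.\<close>

lemma qf_two: "qf M (\<lambda>i. (if i = k then x else 0) + (if i = l then y else 0)) =
   cnj x * x * M $ k $ k + cnj y * y * M $ l $ l + cnj x * y * M $ k $ l + cnj y * x * M $ l $ k"
proof -
  let ?d = "\<lambda>m z i. if i = m then z else (0::complex)"
  have *: "(\<Sum>i\<in>UNIV. \<Sum>j\<in>UNIV. cnj (?d m z i) * M $ i $ j * ?d n w j) = cnj z * M $ m $ n * w" for m n z w
  proof -
    have e: "cnj (?d m z i) * M $ i $ j * ?d n w j
        = (if i = m then if j = n then cnj z * M $ m $ n * w else 0 else 0)" for i j
      by auto
    have if_sum: "(\<Sum>j\<in>UNIV. if b then f j else (0::complex)) = (if b then \<Sum>j\<in>UNIV. f j else 0)"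
      for b and f :: "'a \<Rightarrow> complex" by simp
    show ?thesis
      unfolding e if_sum by simp
  qed
  show ?thesis
    unfolding qf_def complex_cnj_add distrib_left distrib_right sum.distrib *
    by (simp add: algebra_simps)
qed

lemma qf_unit: "qf M (\<lambda>i. if i = k then 1 else 0) = M $ k $ k"
  using qf_two[of M k 1 k 0] by simp

lemma qf_scale_vec: "qf M (\<lambda>i. c * v i) = of_real ((cmod c)\<^sup>2) * qf M v"
  unfolding complex_norm_square qf_def sum_distrib_left
  by (intro sum.cong refl) (simp add: mult_ac)

text \<open>Polarization over the complex field: the vectors with coefficients (1, 1) and (1,
  \<open>\<i>\<close>) give the sum and the difference of the two off-diagonal entries. This is how
  equality of matrices is checked throughout.\<close>

lemma qf_zeroD:
  assumes "\<And>v. qf M v = 0"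
  shows "M = 0"
proof -
  have "M $ k $ l = 0" for k l
  proof -
    have d: "M $ k $ k = 0" "M $ l $ l = 0"
      using assms qf_unit by metis+
    have "M $ k $ l + M $ l $ k = 0"
      using qf_two[of M k 1 l 1] d assms by simp
    moreover have "\<i> * M $ k $ l - \<i> * M $ l $ k = 0"
      using qf_two[of M k 1 l \<i>] d assms by simp
    ultimately show ?thesis by (simp add: algebra_simps)
  qed
  then show ?thesis by (simp add: vec_eq_iff)
qed

lemma psd_0: "psd 0"
  by (simp add: psd_iff)

lemma psd_add: "psd M \<Longrightarrow> psd N \<Longrightarrow> psd (M + N)"
  by (simp add: psd_iff qf_add nonneg_Reals_add_I)

lemma psd_scaleR: "psd M \<Longrightarrow> 0 \<le> r \<Longrightarrow> psd (r *\<^sub>R M)"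
  by (simp add: psd_iff qf_scaleR complex_nonneg_Reals_iff)

lemma psd_outer: "psd (outer a)"
  by (simp add: psd_iff qf_outer del: of_real_power)

lemma psd_diag: "psd M \<Longrightarrow> M $ k $ k \<in> \<real>\<^sub>\<ge>\<^sub>0"
  using qf_unit psd_iff by metis

text \<open>Positivity includes that the form is real. Testing this with coefficients (1, 1) and (1,
  \<open>\<i>\<close>) gives the imaginary and the real part of the symmetry.\<close>

lemma psd_hermitian:
  assumes "psd M"
  shows "M $ l $ k = cnj (M $ k $ l)"
proof -
  have d: "Im (M $ k $ k) = 0" "Im (M $ l $ l) = 0"
    using psd_diag[OF assms] by (auto simp: complex_nonneg_Reals_iff)
  have i: "Im (qf M v) = 0" for v
    using assms by (auto simp: psd_iff complex_nonneg_Reals_iff)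
  have "Im (M $ k $ l) + Im (M $ l $ k) = 0"
    using i[of "\<lambda>i. (if i = k then 1 else 0) + (if i = l then 1 else 0)"] d unfolding qf_two by simp
  moreover have "Re (M $ k $ l) - Re (M $ l $ k) = 0"
    using i[of "\<lambda>i. (if i = k then 1 else 0) + (if i = l then \<i> else 0)"] d unfolding qf_two by simp
  ultimately show ?thesis by (simp add: complex_eq_iff)
qed

lemma trace_nonneg: "psd M \<Longrightarrow> trace M \<in> \<real>\<^sub>\<ge>\<^sub>0"
  unfolding trace_def using psd_diag[of M] by (simp add: complex_nonneg_Reals_iff sum_nonneg)

text \<open>Lagrange's identity: sum the form over the vectors \<open>cnj (a l) e\<^sub>k - cnj (a k) e\<^sub>l\<close>.\<close>
lemma qf_le_trace:
  assumes "psd M"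
  shows "Re (qf M a) \<le> sqnorm a * Re (trace M)"
proof -
  define q where "q k l = cnj (a l) * a l * M $ k $ k + cnj (a k) * a k * M $ l $ l
     - a l * cnj (a k) * M $ k $ l - a k * cnj (a l) * M $ l $ k" for k l
  have "0 \<le> Re (q k l)" for k l
  proof -
    have "q k l = qf M (\<lambda>i. (if i = k then cnj (a l) else 0) + (if i = l then - cnj (a k) else 0))"
      unfolding qf_two q_def by (simp add: algebra_simps)
    then show ?thesis using assms by (simp add: psd_iff complex_nonneg_Reals_iff)
  qed
  then have "0 \<le> Re (\<Sum>k\<in>UNIV. \<Sum>l\<in>UNIV. q k l)"
    by (simp add: sum_nonneg)
  moreover have "(\<Sum>k\<in>UNIV. \<Sum>l\<in>UNIV. q k l) = 2 * (of_real (sqnorm a) * trace M - qf M a)"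
  proof -
    have 1: "(\<Sum>k\<in>UNIV. \<Sum>l\<in>UNIV. cnj (a l) * a l * M $ k $ k) = of_real (sqnorm a) * trace M"
    proof -
      have sq: "of_real (sqnorm a) = (\<Sum>l\<in>UNIV. cnj (a l) * a l)"
        by (simp add: sqnorm_def complex_norm_square mult.commute del: of_real_power)
      show ?thesis
        unfolding sq trace_def sum_distrib_right[symmetric] by (simp add: sum_distrib_left)
    qed
    have 2: "(\<Sum>k\<in>UNIV. \<Sum>l\<in>UNIV. cnj (a k) * a k * M $ l $ l) = of_real (sqnorm a) * trace M"
      by (subst sum.swap) (rule 1)
    have 3: "(\<Sum>k\<in>UNIV. \<Sum>l\<in>UNIV. a l * cnj (a k) * M $ k $ l) = qf M a"
      by (simp add: qf_def algebra_simps)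
    have 4: "(\<Sum>k\<in>UNIV. \<Sum>l\<in>UNIV. a k * cnj (a l) * M $ l $ k) = qf M a"
      by (subst sum.swap) (rule 3)
    show ?thesis
      unfolding q_def sum.distrib sum_subtractf 1 2 3 4 by simp
  qed
  ultimately show ?thesis by simp
qed

text \<open>A positive matrix lies below its trace times the identity, by
  \<open>qf_le_trace\<close>. This turns a short enough \<open>outer a\<close> into one outcome of a
  two-outcome observable.\<close>

lemma psd_mat_1_minus:
  assumes "psd M" "Re (trace M) \<le> 1"
  shows "psd (mat 1 - M)"
proof -
  have "Re (qf M v) \<le> sqnorm v" for v
    using qf_le_trace[OF assms(1), of v] mult_left_mono[OF assms(2) sqnorm_nonneg[of v]] by simp
  then show ?thesis
    using assms(1) by (simp add: psd_iff qf_diff qf_mat_1 complex_nonneg_Reals_iff)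
qed

lemma trace_scaleR: "trace (r *\<^sub>R (M :: complex^'a^'a)) = of_real r * trace M"
  by (simp add: trace_def sum_distrib_left scaleR_conv_of_real[where 'a=complex])

lemma trace_cscale: "trace (cscale c M) = c * trace M"
  by (simp add: trace_def cscale_def sum_distrib_left)

lemma trace_outer_mult: "trace (outer a ** M) = qf M a"
proof -
  have "trace (outer a ** M) = (\<Sum>i\<in>UNIV. \<Sum>k\<in>UNIV. cnj (a k) * M $ k $ i * a i)"
    unfolding trace_def matrix_matrix_mult_def outer_def
    by (simp add: mult_ac)
  also have "\<dots> = qf M a"
    unfolding qf_def by (rule sum.swap)
  finally show ?thesis .
qed

lemma trace_outer: "trace (outer a) = of_real (sqnorm a)"
  unfolding sqnorm_def of_real_sum complex_norm_square by (simp add: trace_def outer_def)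

subsection \<open>Cholesky decomposition\<close>

text \<open>If the entry \<open>z\<close> were nonzero, the form at the vector with entries
  \<open>- t * z\<close> at \<open>k\<close> and 1 at \<open>l\<close> would equal
  \<open>d - 2 * t * (cmod z)\<^sup>2\<close>, which is unbounded below in \<open>t\<close>.\<close>

lemma psd_entry_zero:
  assumes "psd M" "M $ k $ k = 0"
  shows "M $ k $ l = 0"
proof (rule ccontr)
  define z where "z = M $ k $ l"
  define d where "d = Re (M $ l $ l)"
  assume "M $ k $ l \<noteq> 0"
  then have z: "cmod z > 0" by (simp add: z_def)
  have lk: "M $ l $ k = cnj z" unfolding z_def by (rule psd_hermitian[OF assms(1)])
  have "0 \<le> Re (qf M (\<lambda>i. (if i = k then - of_real t * z else 0) + (if i = l then 1 else 0)))" for t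
    using assms(1) by (simp add: psd_iff complex_nonneg_Reals_iff)
  then have *: "0 \<le> d - 2 * t * (cmod z)\<^sup>2" for t
    unfolding qf_two lk using assms(2)
    by (simp add: z_def[symmetric] d_def cmod_power2) (simp add: algebra_simps power2_eq_square)
  \<comment> \<open>This \<open>t\<close> is chosen so that the supposedly nonnegative value is
    exactly -1.\<close>
  have "d - 2 * ((d + 1) / (2 * (cmod z)\<^sup>2)) * (cmod z)\<^sup>2 = -1"
    using z by (simp add: field_simps)
  with *[of "(d + 1) / (2 * (cmod z)\<^sup>2)"] show False by linarith
qed

text \<open>Completing the square: subtracting the normalized column \<open>k\<close> changes the
  form at \<open>v\<close> into the form of \<open>M\<close> at a vector \<open>w\<close> that
  differs from \<open>v\<close> only in coordinate \<open>k\<close>.\<close>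

lemma psd_schur_complement:
  assumes "psd M" "M $ k $ k \<noteq> 0"
  shows "psd (M - outer (\<lambda>i. M $ i $ k / of_real (sqrt (Re (M $ k $ k)))))"
proof -
  define m where "m = Re (M $ k $ k)"
  have m: "m > 0" "M $ k $ k = of_real m"
    using psd_diag[OF assms(1), of k] assms(2) unfolding m_def
    by (auto simp: complex_nonneg_Reals_iff complex_eq_iff)
  have "qf (M - outer (\<lambda>i. M $ i $ k / of_real (sqrt m))) v \<in> \<real>\<^sub>\<ge>\<^sub>0" for v
  proof -
    define s where "s = (\<Sum>i\<in>UNIV. M $ k $ i * v i)"
    \<comment> \<open>The correction is chosen so that row \<open>k\<close> of \<open>M\<close>
      annihilates \<open>w\<close>.\<close>
    define w where "w = (\<lambda>i. v i - (if i = k then s / of_real m else 0))"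
    have cs: "cnj s = (\<Sum>i\<in>UNIV. cnj (v i) * M $ i $ k)"
      by (simp add: s_def psd_hermitian[OF assms(1), symmetric] mult.commute)
    have "qf (outer (\<lambda>i. M $ i $ k / of_real (sqrt m))) v = s * cnj s / of_real m"
    proof -
      have "(\<Sum>i\<in>UNIV. cnj (v i) * (M $ i $ k / of_real (sqrt m))) = cnj s / of_real (sqrt m)"
        unfolding cs by (simp add: sum_divide_distrib)
      then have "qf (outer (\<lambda>i. M $ i $ k / of_real (sqrt m))) v = of_real ((cmod (cnj s / of_real (sqrt m)))\<^sup>2)"
        unfolding qf_outer by simp
      also have "(cmod (cnj s / of_real (sqrt m)))\<^sup>2 = (cmod s)\<^sup>2 / m"
        using m by (simp add: norm_divide power_divide)
      finally show ?thesis by (simp add: complex_norm_square del: of_real_power)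
    qed
    moreover have "qf M w = qf M v - s * cnj s / of_real m"
    proof -
      let ?d = "\<lambda>i. if i = k then s / of_real m else 0"
      have e: "cnj (w i) * M $ i $ j * w j = cnj (v i) * M $ i $ j * v j
          - (if j = k then cnj (v i) * M $ i $ k * (s / of_real m) else 0)
          - (if i = k then cnj (s / of_real m) * (M $ k $ j * v j) else 0)
          + (if i = k then if j = k then cnj (s / of_real m) * M $ k $ k * (s / of_real m) else 0 else 0)" for i j
        by (auto simp: w_def algebra_simps)
      have if_sum: "(\<Sum>j\<in>UNIV. if b then f j else (0::complex)) = (if b then \<Sum>j\<in>UNIV. f j else 0)"
        for b and f :: "'a \<Rightarrow> complex" by simp
      have "qf M w = qf M v - cnj s * (s / of_real m) - cnj (s / of_real m) * s
           + cnj (s / of_real m) * M $ k $ k * (s / of_real m)"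
        unfolding qf_def e sum.distrib sum_subtractf if_sum
        by (simp add: cs s_def[symmetric] sum_distrib_left[symmetric] sum_distrib_right[symmetric]
            sum_divide_distrib[symmetric] del: complex_cnj_divide)
      moreover have "cnj (s / of_real m) * M $ k $ k * (s / of_real m) = cnj s * (s / of_real m)"
        using m by simp
      ultimately show ?thesis by (simp add: mult.commute)
    qed
    ultimately have "qf (M - outer (\<lambda>i. M $ i $ k / of_real (sqrt m))) v = qf M w"
      by (simp add: qf_diff)
    then show ?thesis using assms(1) by (simp add: psd_iff)
  qed
  then show ?thesis by (simp add: psd_iff m_def)
qed

text \<open>Every positive matrix is a finite sum of rank-one matrices \<open>outer a\<close>, so
  properties that are additive need only be checked on those; no spectral decomposition enters. Each
  Schur complement lowers the number of nonzero diagonal entries.\<close>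

lemma psd_induct [consumes 1, case_names zero add_outer]:
  assumes "psd M" and zero: "P 0" and add: "\<And>A a. psd A \<Longrightarrow> P A \<Longrightarrow> P (A + outer a)"
  shows "P M"
  using assms(1)
proof (induction "card {k. M $ k $ k \<noteq> 0}" arbitrary: M rule: less_induct)
  case less
  show ?case
  proof (cases "\<exists>k. M $ k $ k \<noteq> 0")
    case False
    then have "M = 0" using psd_entry_zero[OF less.prems] by (simp add: vec_eq_iff)
    then show ?thesis using zero by simp
  next
    case True
    then obtain k where k: "M $ k $ k \<noteq> 0" by blast
    define a where "a = (\<lambda>i. M $ i $ k / of_real (sqrt (Re (M $ k $ k))))"
    have p: "psd (M - outer a)"
      unfolding a_def by (rule psd_schur_complement[OF less.prems k])
    have m: "Re (M $ k $ k) > 0" "Im (M $ k $ k) = 0"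
      using psd_diag[OF less.prems, of k] k by (auto simp: complex_nonneg_Reals_iff complex_eq_iff)
    have "(M - outer a) $ k $ k = 0"
    proof -
      have "outer a $ k $ k = of_real ((cmod (a k))\<^sup>2)"
        by (simp add: outer_def complex_norm_square del: of_real_power)
      also have "(cmod (a k))\<^sup>2 = Re (M $ k $ k)"
        using m by (simp add: a_def norm_divide power_divide cmod_power2) (simp add: power2_eq_square)
      finally show ?thesis using m by (simp add: complex_eq_iff)
    qed
    \<comment> \<open>A zero diagonal entry forces a zero row, so \<open>a\<close> vanishes at
      \<open>l\<close> and entries cleared earlier stay cleared.\<close>
    moreover have "(M - outer a) $ l $ l = 0" if "M $ l $ l = 0" for l
      using psd_entry_zero[OF less.prems that, of k] that by (simp add: outer_def a_def)
    ultimately have "{l. (M - outer a) $ l $ l \<noteq> 0} \<subset> {l. M $ l $ l \<noteq> 0}"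
      using k by auto
    then have "P (M - outer a)"
      using less.hyps p by (simp add: psubset_card_mono)
    from add[OF p this, of a] show ?thesis by simp
  qed
qed

subsection \<open>Mean ergodic projection\<close>

lemma linear_funpow:
  fixes f :: "'a::real_vector \<Rightarrow> 'a"
  assumes "linear f"
  shows "linear (f ^^ k)"
proof (induction k)
  case 0
  show ?case by (rule linearI) simp_all
next
  case (Suc k)
  then show ?case using linear_compose[OF _ assms, of "f ^^ k"] by (simp only: funpow.simps)
qed

text \<open>With \<open>g = f - id\<close>, the space is the direct sum of the kernel and the range
  of \<open>g\<close>. The averages are constant on the kernel and tend to 0 on the range, so they
  converge to the projection onto the kernel along the range.\<close>

lemma mean_ergodic:
  fixes f :: "'a::euclidean_space \<Rightarrow> 'a"
  assumes lin: "linear f" and bdd: "\<And>x. bounded (range (\<lambda>n. (f ^^ n) x))"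
  obtains P where "linear P" "\<And>x. f (P x) = P x" "\<And>x. f x = x \<Longrightarrow> P x = x"
    "\<And>x. (\<lambda>n. (1 / real n) *\<^sub>R (\<Sum>k<n. (f ^^ k) x)) \<longlonglongrightarrow> P x"
proof -
  define g where "g = (\<lambda>x. f x - x)"
  define avg where "avg = (\<lambda>x n. (1 / real n) *\<^sub>R (\<Sum>k<n. (f ^^ k) x))"
  have ling: "linear g"
    by (rule linearI) (simp_all add: g_def linear_add[OF lin] linear_scale[OF lin] algebra_simps)
  note pow = linear_funpow[OF lin]
  have tele: "(\<Sum>k<n. (f ^^ k) (g z)) = (f ^^ n) z - z" for n z
    by (induction n) (simp_all add: g_def linear_diff[OF pow] funpow_Suc_right del: funpow.simps(2))
  have avg_fix: "avg x \<longlonglongrightarrow> x" if "f x = x" for x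
  proof -
    have "(f ^^ k) x = x" for k by (induction k) (auto simp: that)
    \<comment> \<open>At \<open>n = 0\<close> the average is 0, because \<open>1 / 0 = 0\<close>;
      hence the limit is obtained from eventual equality.\<close>
    then have "avg x n = x" if "n > 0" for n
      using that by (simp add: avg_def sum_constant_scaleR)
    then show ?thesis
      by (intro tendsto_eventually eventually_sequentiallyI[of 1]) auto
  qed
  have avg_g: "avg (g z) \<longlonglongrightarrow> 0" for z
  proof -
    obtain C where C: "\<And>n. norm ((f ^^ n) z) \<le> C"
      using bdd[of z] by (auto simp: bounded_iff)
    have "norm (avg (g z) n) \<le> (C + norm z) / real n" for n
    proof -
      have "norm ((f ^^ n) z - z) \<le> C + norm z"
        using C[of n] norm_triangle_ineq4[of "(f ^^ n) z" z] by linarith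
      then show ?thesis
        unfolding avg_def tele by (simp add: divide_right_mono)
    qed
    then have "\<forall>\<^sub>F n in sequentially. norm (avg (g z) n) \<le> (C + norm z) / real n"
      by simp
    moreover have "(\<lambda>n. (C + norm z) / real n) \<longlonglongrightarrow> 0"
      by (rule lim_const_over_n)
    ultimately show ?thesis
      by (rule Lim_null_comparison)
  qed
  \<comment> \<open>Kernel and range meet only in 0, since on a common element the averages have
    both limits.\<close>
  have ker: "y = 0" if "g y = 0" "y \<in> range g" for y
  proof -
    have "avg y \<longlonglongrightarrow> y" using that(1) avg_fix by (simp add: g_def)
    moreover have "avg y \<longlonglongrightarrow> 0" using that(2) avg_g by blast
    ultimately show ?thesis by (rule LIMSEQ_unique)
  qed
  have sub: "subspace (range g)"
    by (rule linear_subspace_image[OF ling subspace_UNIV])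
  have "inj_on g (range g)"
  proof (rule inj_onI)
    fix x y assume "x \<in> range g" "y \<in> range g" "g x = g y"
    then show "x = y"
      using ker[of "x - y"] subspace_diff[OF sub, of x y] by (simp add: linear_diff[OF ling])
  qed
  \<comment> \<open>An injective linear map from the finite-dimensional range of \<open>g\<close>
    into itself is onto. So \<open>g w = g (g z)\<close> is solvable for every \<open>w\<close>, and
    \<open>w - g z\<close> lies in the kernel.\<close>
  then have "dim (g ` range g) = dim (range g)"
    using dim_image_eq[OF ling, of "range g"] sub by (simp add: span_eq_iff[THEN iffD2])
  then have "g ` range g = range g"
    using subspace_dim_equal[OF linear_subspace_image[OF ling sub] sub] by auto
  then have "\<exists>z. g w = g (g z)" for w
    by (metis (no_types, lifting) imageE rangeI)
  then have "\<exists>x z. w = x + g z \<and> g x = 0" for w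
    by (metis add.commute diff_add_cancel linear_diff[OF ling] right_minus_eq)
  then obtain P Z where PZ: "\<And>w. w = P w + g (Z w)" and fixP: "\<And>w. g (P w) = 0"
    by metis
  have lim: "avg w \<longlonglongrightarrow> P w" for w
  proof -
    have "avg w = (\<lambda>n. avg (P w) n + avg (g (Z w)) n)"
      unfolding avg_def scaleR_add_right[symmetric] sum.distrib[symmetric]
        linear_add[OF pow, symmetric] PZ[symmetric] ..
    then show ?thesis
      using tendsto_add[OF avg_fix avg_g, of "P w" "Z w"] fixP[of w] by (simp add: g_def)
  qed
  have "linear P"
  proof
    fix x y
    have "avg (x + y) = (\<lambda>n. avg x n + avg y n)"
      by (simp add: avg_def linear_add[OF pow] sum.distrib scaleR_add_right)
    then show "P (x + y) = P x + P y"
      using lim[of "x + y"] tendsto_add[OF lim[of x] lim[of y]] LIMSEQ_unique by metis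
  next
    fix r x
    have "avg (r *\<^sub>R x) = (\<lambda>n. r *\<^sub>R avg x n)"
      by (simp add: avg_def linear_scale[OF pow] scaleR_sum_right mult.commute)
    then show "P (r *\<^sub>R x) = r *\<^sub>R P x"
      using lim[of "r *\<^sub>R x"] tendsto_scaleR[OF tendsto_const[of r] lim[of x]] LIMSEQ_unique by metis
  qed
  moreover have "f (P x) = P x" for x
    using fixP[of x] by (simp add: g_def)
  moreover have "P x = x" if "f x = x" for x
    using LIMSEQ_unique[OF lim avg_fix[OF that]] .
  ultimately show thesis
    using that lim unfolding avg_def by blast
qed

text \<open>Applying \<open>L a - t a y\<close> to a vanishing combination removes \<open>y\<close>
  and multiplies the coefficient of each other \<open>x\<close> by \<open>t a x - t a y\<close>. By
  induction these products vanish for every \<open>a\<close>, and some \<open>a\<close> separates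
  \<open>x\<close> from \<open>y\<close>.\<close>

lemma independent_joint_eigenvectors:
  fixes L :: "'k \<Rightarrow> 'v::real_vector \<Rightarrow> 'v"
  assumes lin: "\<And>a. linear (L a)" and eig: "\<And>a x. x \<in> B \<Longrightarrow> L a x = t a x *\<^sub>R x"
    and sep: "\<And>x y. x \<in> B \<Longrightarrow> y \<in> B \<Longrightarrow> x \<noteq> y \<Longrightarrow> \<exists>a. t a x \<noteq> t a y"
    and nz: "0 \<notin> B"
  shows "independent B"
proof -
  have "\<forall>x\<in>S. c x = 0" if "finite S" "S \<subseteq> B" "(\<Sum>x\<in>S. c x *\<^sub>R x) = 0" for S c
    using that
  proof (induction S arbitrary: c rule: finite_induct)
    case (insert y S)
    have s: "c y *\<^sub>R y + (\<Sum>x\<in>S. c x *\<^sub>R x) = 0"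
      using insert.prems insert.hyps by simp
    have "c x = 0" if x: "x \<in> S" for x
    proof -
      have "(c z * (t a z - t a y)) = 0" if "z \<in> S" for z a
      proof -
        have "0 = L a (c y *\<^sub>R y + (\<Sum>x\<in>S. c x *\<^sub>R x))"
          unfolding s by (simp add: linear_0[OF lin])
        also have "\<dots> = c y *\<^sub>R L a y + (\<Sum>x\<in>S. c x *\<^sub>R L a x)"
          by (simp add: linear_add[OF lin] linear_sum[OF lin] linear_scale[OF lin])
        also have "\<dots> = c y *\<^sub>R t a y *\<^sub>R y + (\<Sum>x\<in>S. c x *\<^sub>R t a x *\<^sub>R x)"
          using insert.prems by (simp add: eig subset_iff)
        finally have "(\<Sum>x\<in>S. (c x * (t a x - t a y)) *\<^sub>R x)
            = - t a y *\<^sub>R (c y *\<^sub>R y + (\<Sum>x\<in>S. c x *\<^sub>R x))"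
          by (simp add: algebra_simps sum_subtractf scaleR_sum_right sum_negf eq_neg_iff_add_eq_0)
        then show ?thesis
          using insert.IH[of "\<lambda>x. c x * (t a x - t a y)"] insert.prems that by (simp add: s)
      qed
      moreover have "\<exists>a. t a x \<noteq> t a y"
        using sep insert.prems insert.hyps x by blast
      ultimately show ?thesis using x by fastforce
    qed
    moreover from this have "c y = 0"
      using s nz insert.prems by auto
    ultimately show ?case by simp
  qed simp
  then show ?thesis
    unfolding independent_explicit_finite_subsets by blast
qed

subsection \<open>The set of states\<close>

text \<open>Coefficients (1, 1) and (1, -1) bound the real part of an off-diagonal entry by the
  trace, and (1, \<open>\<i>\<close>) and (1, \<open>-\<i>\<close>) bound the imaginary
  part.\<close>

lemma cmod_entry_le_trace:
  assumes "psd M"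
  shows "cmod (M $ k $ l) \<le> 2 * Re (trace M)"
proof -
  let ?t = "Re (trace M)"
  have d: "0 \<le> Re (M $ i $ i)" "Re (M $ i $ i) \<le> ?t" for i
  proof -
    have "sqnorm (\<lambda>j. if j = i then 1 else 0) = 1"
      by (simp add: sqnorm_def if_distrib[of cmod] if_distrib[of "\<lambda>x. x\<^sup>2"] cong: if_cong)
    then show "Re (M $ i $ i) \<le> ?t"
      using qf_le_trace[OF assms, of "\<lambda>j. if j = i then 1 else 0"] by (simp add: qf_unit)
    show "0 \<le> Re (M $ i $ i)"
      using psd_diag[OF assms] by (simp add: complex_nonneg_Reals_iff)
  qed
  have h: "M $ l $ k = cnj (M $ k $ l)" by (rule psd_hermitian[OF assms])
  show ?thesis
  proof (cases "k = l")
    case True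
    then show ?thesis
      using d[of k] psd_diag[OF assms, of k]
      by (simp add: cmod_eq_Re complex_nonneg_Reals_iff)
  next
    case False
    have q: "0 \<le> Re (qf M (\<lambda>i. (if i = k then 1 else 0) + (if i = l then u else 0)))"
      for u
      using assms by (simp add: psd_iff complex_nonneg_Reals_iff)
    have "\<bar>Re (M $ k $ l)\<bar> \<le> ?t"
      using q[of 1] q[of "-1"] d[of k] d[of l] unfolding qf_two h by simp
    moreover have "\<bar>Im (M $ k $ l)\<bar> \<le> ?t"
      using q[of "\<i>"] q[of "-\<i>"] d[of k] d[of l] unfolding qf_two h by simp
    ultimately show ?thesis
      using cmod_le[of "M $ k $ l"] by linarith
  qed
qed

text \<open>The constant is crude; what matters is that a bounded trace bounds the norm, both for
  compactness of the states and for boundedness of orbits.\<close>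

lemma norm_le_trace:
  fixes M :: "complex^'n::finite^'n"
  assumes "psd M"
  shows "norm M \<le> 2 * real CARD('n) ^ 2 * Re (trace M)"
proof -
  have "norm M \<le> (\<Sum>i\<in>UNIV. norm (M $ i))"
    unfolding norm_vec_def[of M] by (rule L2_set_le_sum) simp
  also have "\<dots> \<le> (\<Sum>i\<in>UNIV. \<Sum>j\<in>UNIV. cmod (M $ i $ j))"
    by (intro sum_mono) (simp add: norm_vec_def L2_set_le_sum)
  also have "\<dots> \<le> (\<Sum>i\<in>(UNIV::'n set). \<Sum>j\<in>(UNIV::'n set). 2 * Re (trace M))"
    by (intro sum_mono cmod_entry_le_trace assms)
  finally show ?thesis by (simp add: power2_eq_square)
qed

lemma closed_psd: "closed {M :: complex^'n::finite^'n. psd M}"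
proof -
  have "{M :: complex^'n^'n. psd M} = (\<Inter>v. {M. qf M v \<in> \<real>\<^sub>\<ge>\<^sub>0})"
    by (auto simp: psd_iff)
  moreover have "closed {M :: complex^'n^'n. qf M v \<in> \<real>\<^sub>\<ge>\<^sub>0}" for v
    using closed_vimage[OF closed_nonneg_Reals_complex, of "\<lambda>M. qf M v"]
    by (simp add: qf_def vimage_def continuous_intros)
  ultimately show ?thesis by auto
qed

lemma closed_states: "closed (states :: (complex^'n::finite^'n) set)"
proof -
  have "closed ((trace :: complex^'n^'n \<Rightarrow> complex) -` {1})"
    by (intro closed_vimage closed_singleton) (simp add: trace_def continuous_intros)
  moreover have "(states :: (complex^'n^'n) set) = {M. psd M} \<inter> trace -` {1}"
    by (auto simp: states_def)
  ultimately show ?thesis using closed_psd by (metis closed_Int)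
qed

lemma compact_states: "compact (states :: (complex^'n::finite^'n) set)"
proof -
  have "bounded (states :: (complex^'n^'n) set)"
    unfolding bounded_iff using norm_le_trace
    by (intro exI[of _ "2 * real CARD('n) ^ 2"]) (fastforce simp: states_def)
  then show ?thesis using closed_states compact_eq_bounded_closed by blast
qed

lemma convex_states: "convex (states :: (complex^'n::finite^'n) set)"
  by (auto simp: convex_def states_def psd_add psd_scaleR trace_add trace_scaleR simp flip: of_real_add)

subsection \<open>Fixed states of a positive trace-preserving map\<close>

lemma inner_mat: "inner W X = Re (\<Sum>i\<in>UNIV. \<Sum>j\<in>UNIV. W $ i $ j * cnj (X $ i $ j))"
  for W X :: "complex^'n::finite^'n"
  by (simp add: inner_vec_def inner_complex_def)

lemma cscale_of_real: "cscale (of_real r) X = r *\<^sub>R X"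
  by (simp add: cscale_def vec_eq_iff scaleR_conv_of_real[where 'a=complex])

text \<open>The span is over the reals, and the matrices \<open>outer a\<close> alone lie in the
  Hermitian ones, so their multiples by \<open>\<i>\<close> are added. A matrix \<open>W\<close>
  orthogonal to both families has a form with vanishing real and imaginary part, hence is 0.\<close>

lemma span_outer: "span (range outer \<union> range (\<lambda>a. cscale \<i> (outer a))) = (UNIV :: (complex^'n::finite^'n) set)"
  (is "span ?S = _")
proof (rule ccontr)
  assume "span ?S \<noteq> UNIV"
  then have "dim ?S < DIM(complex^'n^'n)"
    using dim_eq_full[of ?S] dim_subset_UNIV[of ?S] by linarith
  from orthogonal_to_subspace_exists[OF this]
  obtain W where W: "W \<noteq> 0" "\<And>Y. Y \<in> span ?S \<Longrightarrow> orthogonal W Y"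
    by blast
  have "qf W a = 0" for a
  proof -
    have i: "(\<Sum>i\<in>UNIV. \<Sum>j\<in>UNIV. W $ i $ j * cnj (cscale c (outer a) $ i $ j)) = cnj c * qf W a" for c
      unfolding qf_def sum_distrib_left
      by (intro sum.cong refl) (simp add: outer_def cscale_def)
    then have h: "inner W (cscale c (outer a)) = Re (cnj c * qf W a)" for c
      by (simp only: inner_mat)
    have "Re (qf W a) = 0"
      using W(2)[of "outer a"] h[of 1] by (simp add: orthogonal_def span_base cscale_of_real[of 1, simplified])
    moreover have "Im (qf W a) = 0"
      using W(2)[of "cscale \<i> (outer a)"] h[of \<i>] by (simp add: orthogonal_def span_base)
    ultimately show ?thesis by (simp add: complex_eq_iff)
  qed
  then show False using W(1) qf_zeroD by blast
qed

lemma linear_cscale: "linear (cscale c)"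
  by (rule linearI) (simp_all add: cscale_def vec_eq_iff algebra_simps)

text \<open>Powers of \<open>E\<close> keep positivity and trace, so orbits of positive matrices are
  bounded. The matrices with bounded orbit form a subspace containing the spanning set of
  \<open>span_outer\<close>, so \<open>mean_ergodic\<close> applies, and positivity and trace pass
  to the limit of the averages.\<close>

lemma positive_projection:
  fixes E :: "complex^'n::finite^'n \<Rightarrow> complex^'n^'n"
  assumes lin: "linear E" and cs: "\<And>c X. E (cscale c X) = cscale c (E X)"
    and pos: "\<And>X. psd X \<Longrightarrow> psd (E X)" and tr: "\<And>X. trace (E X) = trace X"
  obtains P where "linear P" "\<And>X. E (P X) = P X" "\<And>X. E X = X \<Longrightarrow> P X = X"
    "\<And>X. psd X \<Longrightarrow> psd (P X)" "\<And>X. trace (P X) = trace X"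
proof -
  note pow = linear_funpow[OF lin]
  have powtr: "trace ((E ^^ k) X) = trace X" for k X
    by (induction k) (auto simp: tr)
  have powpos: "psd ((E ^^ k) X)" if "psd X" for k X
    by (induction k) (auto simp: that pos)
  have powcs: "(E ^^ k) (cscale c X) = cscale c ((E ^^ k) X)" for k c X
    by (induction k) (auto simp: cs)
  define V where "V = {X. bounded (range (\<lambda>n. (E ^^ n) X))}"
  have "subspace V"
  proof (rule subspaceI)
    show "0 \<in> V" by (simp add: V_def linear_0[OF pow])
  next
    fix x y assume "x \<in> V" "y \<in> V"
    then show "x + y \<in> V"
      using bounded_plus_comp[of "\<lambda>n. (E ^^ n) x" UNIV "\<lambda>n. (E ^^ n) y"]
      by (simp add: V_def linear_add[OF pow])
  next
    fix c x assume "x \<in> V"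
    then show "c *\<^sub>R x \<in> V"
      using bounded_scaleR_comp[of "\<lambda>n. (E ^^ n) x" UNIV c]
      by (simp add: V_def linear_scale[OF pow])
  qed
  moreover have o: "outer a \<in> V" for a
  proof -
    have "norm ((E ^^ k) (outer a)) \<le> 2 * real CARD('n) ^ 2 * Re (trace (outer a))" for k
      using norm_le_trace[OF powpos[OF psd_outer]] powtr by metis
    then show ?thesis by (auto simp: V_def bounded_iff)
  qed
  moreover have "cscale \<i> (outer a) \<in> V" for a
  proof -
    have "bounded_linear (cscale \<i> :: complex^'n^'n \<Rightarrow> _)"
      using linear_cscale linear_conv_bounded_linear by blast
    from bounded_linear_image[OF _ this, of "range (\<lambda>n. (E ^^ n) (outer a))"] o[of a]
    show ?thesis by (simp add: V_def powcs image_image)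
  qed
  ultimately have "V = UNIV"
    using span_outer[where 'n='n] span_minimal[of "range outer \<union> range (\<lambda>a. cscale \<i> (outer a))" V] by blast
  then have "\<And>X. bounded (range (\<lambda>n. (E ^^ n) X))" by (auto simp: V_def)
  from mean_ergodic[OF lin this] obtain P where
    P: "linear P" "\<And>X. E (P X) = P X" "\<And>X. E X = X \<Longrightarrow> P X = X"
    and lim: "\<And>X. (\<lambda>n. (1 / real n) *\<^sub>R (\<Sum>k<n. (E ^^ k) X)) \<longlonglongrightarrow> P X" by blast
  have "psd (P X)" if "psd X" for X
  proof -
    have "psd (\<Sum>k<n. (E ^^ k) X)" for n
      by (induction n) (auto simp: psd_0 psd_add powpos that)
    then have "(1 / real n) *\<^sub>R (\<Sum>k<n. (E ^^ k) X) \<in> {M. psd M}" for n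
      by (simp add: psd_scaleR)
    from closed_sequentially[OF closed_psd this lim] show ?thesis by simp
  qed
  moreover have "trace (P X) = trace X" for X
  proof -
    have "trace (\<Sum>k<n. (E ^^ k) X) = of_nat n * trace X" for n
      by (induction n) (auto simp: trace_add powtr algebra_simps trace_0[unfolded mat_0])
    then have "trace ((1 / real n) *\<^sub>R (\<Sum>k<n. (E ^^ k) X)) = trace X" if "n \<ge> 1" for n
      using that by (simp add: trace_scaleR)
    then have "(\<lambda>n. trace ((1 / real n) *\<^sub>R (\<Sum>k<n. (E ^^ k) X))) \<longlonglongrightarrow> trace X"
      by (intro tendsto_eventually eventually_sequentiallyI[of 1])
    moreover have "(\<lambda>n. trace ((1 / real n) *\<^sub>R (\<Sum>k<n. (E ^^ k) X))) \<longlonglongrightarrow> trace (P X)"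
      unfolding trace_def by (intro tendsto_intros lim)
    ultimately show ?thesis by (rule LIMSEQ_unique[symmetric])
  qed
  ultimately show thesis using that P by blast
qed

text \<open>The multiple \<open>c *\<^sub>R w\<close> splits into the positive fixed points
  \<open>Y\<close> and \<open>c *\<^sub>R w - Y\<close>. After normalization this is a convex
  decomposition of the extreme point \<open>w\<close>, so \<open>Y\<close> is a multiple of
  \<open>w\<close>.\<close>

lemma extreme_fixed_state:
  assumes lin: "linear E" and w: "w extreme_point_of Fix E"
    and Y: "psd Y" "E Y = Y" "psd (c *\<^sub>R w - Y)"
  shows "Y = Re (trace Y) *\<^sub>R w"
proof -
  have wF: "w \<in> Fix E" using w by (simp add: extreme_point_of_def)
  then have w1: "psd w" "trace w = 1" "E w = w" by (auto simp: Fix_def states_def)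
  \<comment> \<open>Adding \<open>w\<close> to both summands makes their traces at least 1, so that
    both can be normalized even if \<open>Y\<close> or its complement is 0.\<close>
  define A where "A = Y + w"
  define B where "B = (c *\<^sub>R w - Y) + w"
  define a where "a = Re (trace Y) + 1"
  define b where "b = c - Re (trace Y) + 1"
  have trY: "trace Y = of_real (Re (trace Y))" "0 \<le> Re (trace Y)"
    using trace_nonneg[OF Y(1)] by (auto simp: complex_nonneg_Reals_iff complex_eq_iff)
  have ps: "psd A" "psd B" unfolding A_def B_def using Y w1 by (auto intro: psd_add)
  have fx: "E A = A" "E B = B"
    unfolding A_def B_def using Y w1 by (simp_all add: linear_add[OF lin] linear_diff[OF lin] linear_scale[OF lin])
  have trA: "trace A = of_real a"
    unfolding A_def trace_add w1 a_def using trY(1) by simp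
  have trB: "trace B = of_real b"
    unfolding B_def trace_add trace_sub trace_scaleR w1 b_def using trY(1) by simp
  have a: "a \<ge> 1" using trY by (simp add: a_def)
  have b: "b \<ge> 1"
    using trace_nonneg[OF Y(3)] by (simp add: trace_sub trace_scaleR w1 b_def complex_nonneg_Reals_iff)
  have AB: "A + B = (a + b) *\<^sub>R w"
    by (simp add: A_def B_def a_def b_def algebra_simps scaleR_2)
  have in_F: "(1 / a) *\<^sub>R A \<in> Fix E" "(1 / b) *\<^sub>R B \<in> Fix E"
    using a b ps fx trA trB
    by (auto simp: Fix_def states_def psd_scaleR trace_scaleR linear_scale[OF lin])
  have "(1 / a) *\<^sub>R A = w"
  proof (rule ccontr)
    assume neq: "(1 / a) *\<^sub>R A \<noteq> w"
    define u where "u = b / (a + b)"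
    have u: "0 < u" "u < 1" "1 - u = a / (a + b)" using a b by (auto simp: u_def field_simps)
    have "w = (1 / (a + b)) *\<^sub>R (A + B)" unfolding AB using a b by simp
    also have "\<dots> = (1 - u) *\<^sub>R ((1 / a) *\<^sub>R A) + u *\<^sub>R ((1 / b) *\<^sub>R B)"
      unfolding u using a b by (simp add: u_def scaleR_add_right)
    finally have eq: "w = (1 - u) *\<^sub>R ((1 / a) *\<^sub>R A) + u *\<^sub>R ((1 / b) *\<^sub>R B)" .
    have "(1 / a) *\<^sub>R A \<noteq> (1 / b) *\<^sub>R B"
    proof
      assume "(1 / a) *\<^sub>R A = (1 / b) *\<^sub>R B"
      with eq have "w = (1 - u) *\<^sub>R ((1 / a) *\<^sub>R A) + u *\<^sub>R ((1 / a) *\<^sub>R A)" by simp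
      then have "w = (1 / a) *\<^sub>R A" by (simp only: scaleR_add_left[symmetric]) simp
      with neq show False by simp
    qed
    then have "w \<in> open_segment ((1 / a) *\<^sub>R A) ((1 / b) *\<^sub>R B)"
      using u eq in_segment(2) by blast
    then show False using w in_F by (auto simp: extreme_point_of_def)
  qed
  then have "A = a *\<^sub>R w" using a by (auto simp: field_simps)
  then show ?thesis by (simp add: A_def a_def algebra_simps)
qed

subsection \<open>Contraction of one tensor factor\<close>

text \<open>The partial trace over the first factor after multiplying by \<open>outer a\<close> on
  that factor; \<open>contr2\<close> does the same on the second factor. Up to normalization it is
  the conditional state of one output given outcome \<open>a\<close> on the other.\<close>

definition contr1 :: "('a \<Rightarrow> complex) \<Rightarrow> complex^('a::finite \<times> 'b::finite)^('a \<times> 'b) \<Rightarrow> complex^'b^'b" where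
  "contr1 a Y = (\<chi> i j. \<Sum>k\<in>UNIV. \<Sum>l\<in>UNIV. cnj (a k) * Y $ (k, i) $ (l, j) * a l)"

definition contr2 :: "('b \<Rightarrow> complex) \<Rightarrow> complex^('a::finite \<times> 'b::finite)^('a \<times> 'b) \<Rightarrow> complex^'a^'a" where
  "contr2 a Y = (\<chi> i j. \<Sum>k\<in>UNIV. \<Sum>l\<in>UNIV. cnj (a k) * Y $ (i, k) $ (j, l) * a l)"

lemma sum_pairs: "(\<Sum>p\<in>(UNIV :: ('a::finite \<times> 'b::finite) set). f p) = (\<Sum>i\<in>UNIV. \<Sum>k\<in>UNIV. f (i, k))"
  by (simp add: sum.cartesian_product)

lemma qf_contr2: "qf (contr2 a Y) v = qf Y (\<lambda>(i, k). v i * a k)"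
proof -
  have "qf (contr2 a Y) v = (\<Sum>i\<in>UNIV. \<Sum>j\<in>UNIV. \<Sum>k\<in>UNIV. \<Sum>l\<in>UNIV.
      cnj (v i * a k) * Y $ (i, k) $ (j, l) * (v j * a l))"
    unfolding qf_def contr2_def vec_lambda_beta sum_distrib_left sum_distrib_right
    by (intro sum.cong refl) (simp add: mult_ac)
  also have "\<dots> = (\<Sum>i\<in>UNIV. \<Sum>k\<in>UNIV. \<Sum>j\<in>UNIV. \<Sum>l\<in>UNIV.
      cnj (v i * a k) * Y $ (i, k) $ (j, l) * (v j * a l))"
    by (intro sum.cong refl) (rule sum.swap)
  finally show ?thesis
    unfolding qf_def sum_pairs by simp
qed

text \<open>Both sides are the form of \<open>Y\<close> at the product vector of \<open>a\<close>
  and \<open>v\<close>.\<close>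

lemma qf_contr_commute: "qf (contr1 a Y) v = qf (contr2 v Y) a"
proof -
  have "qf (contr1 a Y) v = (\<Sum>i\<in>UNIV. \<Sum>j\<in>UNIV. \<Sum>k\<in>UNIV. \<Sum>l\<in>UNIV.
      cnj (v i * a k) * Y $ (k, i) $ (l, j) * (v j * a l))"
    unfolding qf_def contr1_def vec_lambda_beta sum_distrib_left sum_distrib_right
    by (intro sum.cong refl) (simp add: mult_ac)
  also have "\<dots> = (\<Sum>i\<in>UNIV. \<Sum>k\<in>UNIV. \<Sum>j\<in>UNIV. \<Sum>l\<in>UNIV.
      cnj (v i * a k) * Y $ (k, i) $ (l, j) * (v j * a l))"
    by (intro sum.cong refl) (rule sum.swap)
  also have "\<dots> = (\<Sum>k\<in>UNIV. \<Sum>i\<in>UNIV. \<Sum>l\<in>UNIV. \<Sum>j\<in>UNIV.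
      cnj (a k * v i) * Y $ (k, i) $ (l, j) * (a l * v j))"
    by (subst sum.swap) (intro sum.cong refl, subst sum.swap, simp add: mult_ac)
  also have "\<dots> = qf Y (\<lambda>(k, i). a k * v i)"
    unfolding qf_def sum_pairs by simp
  finally show ?thesis unfolding qf_contr2 .
qed

lemma psd_contr2: "psd Y \<Longrightarrow> psd (contr2 a Y)"
  by (simp add: psd_iff qf_contr2)

lemma psd_contr1: "psd Y \<Longrightarrow> psd (contr1 a Y)"
  by (simp add: psd_iff qf_contr_commute qf_contr2)

lemma trace_contr1: "trace (contr1 a Y) = qf (ptrace2 Y) a"
proof -
  have "trace (contr1 a Y) = (\<Sum>k\<in>UNIV. \<Sum>i\<in>UNIV. \<Sum>l\<in>UNIV. cnj (a k) * Y $ (k, i) $ (l, i) * a l)"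
    unfolding trace_def contr1_def vec_lambda_beta by (rule sum.swap)
  also have "\<dots> = (\<Sum>k\<in>UNIV. \<Sum>l\<in>UNIV. \<Sum>i\<in>UNIV. cnj (a k) * Y $ (k, i) $ (l, i) * a l)"
    by (intro sum.cong refl) (rule sum.swap)
  finally show ?thesis
    by (simp add: qf_def ptrace2_def sum_distrib_left sum_distrib_right)
qed

lemma trace_contr2: "trace (contr2 a Y) = qf (ptrace1 Y) a"
proof -
  have "trace (contr2 a Y) = (\<Sum>k\<in>UNIV. \<Sum>i\<in>UNIV. \<Sum>l\<in>UNIV. cnj (a k) * Y $ (i, k) $ (i, l) * a l)"
    unfolding trace_def contr2_def vec_lambda_beta by (rule sum.swap)
  also have "\<dots> = (\<Sum>k\<in>UNIV. \<Sum>l\<in>UNIV. \<Sum>i\<in>UNIV. cnj (a k) * Y $ (i, k) $ (i, l) * a l)"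
    by (intro sum.cong refl) (rule sum.swap)
  finally show ?thesis
    by (simp add: qf_def ptrace1_def sum_distrib_left sum_distrib_right)
qed

text \<open>Each value of the form of a marginal is the trace of a contraction, which is
  positive.\<close>

lemma psd_ptrace2: "psd Y \<Longrightarrow> psd (ptrace2 Y)"
  using trace_contr1 trace_nonneg[OF psd_contr1] by (metis psd_iff)

lemma psd_ptrace1: "psd Y \<Longrightarrow> psd (ptrace1 Y)"
  using trace_contr2 trace_nonneg[OF psd_contr2] by (metis psd_iff)

text \<open>In the contracted factor \<open>outer a\<close> lies below \<open>sqnorm a\<close> times
  the identity. Swapping the roles of \<open>a\<close> and \<open>v\<close> reduces this to
  \<open>qf_le_trace\<close> for \<open>contr1 v Y\<close>.\<close>

lemma contr2_le:
  assumes "psd Y"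
  shows "psd (sqnorm a *\<^sub>R ptrace2 Y - contr2 a Y)"
proof -
  have "Re (qf (contr2 a Y) v) \<le> sqnorm a * Re (qf (ptrace2 Y) v)" for v
    using qf_le_trace[OF psd_contr1[OF assms, of v], of a]
    by (simp add: qf_contr_commute trace_contr1)
  then show ?thesis
    using psd_contr2[OF assms, of a] psd_ptrace2[OF assms]
    by (simp add: psd_iff qf_diff qf_scaleR complex_nonneg_Reals_iff)
qed

lemma contr1_le:
  assumes "psd Y"
  shows "psd (sqnorm a *\<^sub>R ptrace1 Y - contr1 a Y)"
proof -
  have "Re (qf (contr1 a Y) v) \<le> sqnorm a * Re (qf (ptrace1 Y) v)" for v
    using qf_le_trace[OF psd_contr2[OF assms, of v], of a]
    by (simp add: qf_contr_commute trace_contr2)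
  then show ?thesis
    using psd_contr1[OF assms, of a] psd_ptrace1[OF assms]
    by (simp add: psd_iff qf_diff qf_scaleR complex_nonneg_Reals_iff)
qed

lemma trace_ptrace2: "trace (ptrace2 Y) = trace Y"
  by (simp add: trace_def ptrace2_def sum_pairs)

lemma trace_ptrace1: "trace (ptrace1 Y) = trace Y"
  unfolding trace_def ptrace1_def sum_pairs by (simp, rule sum.swap)

lemma linear_contr: "linear (contr1 a)" "linear (contr2 a)" "linear ptrace1" "linear ptrace2"
  by (rule linearI; simp add: contr1_def contr2_def ptrace1_def ptrace2_def vec_eq_iff
      algebra_simps sum.distrib scaleR_sum_right)+

lemma cscale_ptrace: "ptrace1 (cscale c Y) = cscale c (ptrace1 Y)"
   "ptrace2 (cscale c Y) = cscale c (ptrace2 Y)"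
  by (simp_all add: ptrace1_def ptrace2_def cscale_def vec_eq_iff sum_distrib_left)

section \<open>Channels as positive linear maps; matrices determined by functionals and by
  statistics\<close>

lemma channel_linear: "channel L \<Longrightarrow> linear L"
  by (rule linearI) (auto simp: channel_def simp flip: cscale_of_real)

text \<open>Complete positivity with an ancilla of dimension 1, whose index set
  \<open>{..<1}\<close> is the single point 0.\<close>

lemma channel_psd:
  fixes L :: "complex^'a::finite^'a \<Rightarrow> complex^'b::finite^'b"
  assumes "channel L" "psd X"
  shows "psd (L X)"
proof -
  have one: "{..<1::nat} = {0}" by auto
  have s: "(\<Sum>p\<in>(UNIV :: 'c::finite set) \<times> {0::nat}. f p) = (\<Sum>i\<in>UNIV. f (i, 0))" for f :: "_ \<Rightarrow> complex"
    by (rule sum.reindex_bij_witness[of _ "\<lambda>i. (i, 0)" fst]) auto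
  have "psd_on ((UNIV :: 'a set) \<times> {..<1}) (\<lambda>(i, _) (j, _::nat). X $ i $ j)"
    unfolding psd_on_def Let_def one s
  proof
    fix v :: "'a \<times> nat \<Rightarrow> complex"
    show "Im (\<Sum>i\<in>UNIV. \<Sum>j\<in>UNIV. cnj (v (i, 0)) * (case (i, 0::nat) of (i, _) \<Rightarrow> \<lambda>(j, _). X $ i $ j) (j, 0::nat) * v (j, 0)) = 0 \<and>
      0 \<le> Re (\<Sum>i\<in>UNIV. \<Sum>j\<in>UNIV. cnj (v (i, 0)) * (case (i, 0::nat) of (i, _) \<Rightarrow> \<lambda>(j, _). X $ i $ j) (j, 0::nat) * v (j, 0))"
      using assms(2)[unfolded psd_iff qf_def, rule_format, of "\<lambda>i. v (i, 0)"]
      by (simp add: complex_nonneg_Reals_iff)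
  qed
  moreover have "completely_positive L" using assms(1) by (simp add: channel_def)
  ultimately have *: "psd_on ((UNIV :: 'b set) \<times> {..<1::nat})
       (\<lambda>(p, a) (q, b). L (\<chi> i j. (\<lambda>(i, _) (j, _::nat). X $ i $ j) (i, a) (j, b)) $ p $ q)"
    unfolding completely_positive_def by blast
  have X: "(\<chi> i j. X $ i $ j) = X" by (simp add: vec_eq_iff)
  show ?thesis
    unfolding psd_def psd_on_def Let_def
  proof
    fix v :: "'b \<Rightarrow> complex"
    show "Im (\<Sum>i\<in>UNIV. \<Sum>j\<in>UNIV. cnj (v i) * L X $ i $ j * v j) = 0 \<and>
          0 \<le> Re (\<Sum>i\<in>UNIV. \<Sum>j\<in>UNIV. cnj (v i) * L X $ i $ j * v j)"
      using *[unfolded psd_on_def Let_def one s, rule_format, of "\<lambda>(p, _). v p"]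
      by (simp add: X)
  qed
qed

text \<open>The Riesz vector \<open>W\<close> gives \<open>r X\<close> as the real part of a trace
  pairing. Replacing \<open>W\<close> by its Hermitian part \<open>G\<close> makes the pairing with
  Hermitian \<open>X\<close> real, so it equals \<open>r X\<close> itself.\<close>

lemma functional_matrix:
  fixes r :: "complex^'n::finite^'n \<Rightarrow> real"
  assumes "linear r"
  obtains G where "\<And>X. (\<And>i j. X $ j $ i = cnj (X $ i $ j)) \<Longrightarrow> trace (X ** G) = of_real (r X)"
proof -
  define W where "W = adjoint r 1"
  have W: "inner W X = r X" for X
    using adjoint_works[OF assms, of X 1] by (simp add: W_def inner_commute)
  define G :: "complex^'n^'n" where "G = (\<chi> i j. (W $ i $ j + cnj (W $ j $ i)) / 2)"
  show thesis
  proof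
    fix X :: "complex^'n^'n"
    assume X: "\<And>i j. X $ j $ i = cnj (X $ i $ j)"
    define s where "s = (\<Sum>i\<in>UNIV. \<Sum>j\<in>UNIV. W $ i $ j * cnj (X $ i $ j))"
    have 1: "(\<Sum>j\<in>UNIV. \<Sum>i\<in>UNIV. X $ j $ i * W $ i $ j) = s"
      unfolding s_def by (subst sum.swap) (intro sum.cong refl, simp add: X[symmetric] mult.commute)
    have 2: "(\<Sum>j\<in>UNIV. \<Sum>i\<in>UNIV. X $ j $ i * cnj (W $ j $ i)) = cnj s"
      by (simp add: s_def mult.commute)
    have "trace (X ** G) = (\<Sum>j\<in>UNIV. \<Sum>i\<in>UNIV. (X $ j $ i * W $ i $ j + X $ j $ i * cnj (W $ j $ i)) / 2)"
      by (simp add: trace_def matrix_matrix_mult_def G_def algebra_simps)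
    also have "\<dots> = (s + cnj s) / 2"
      unfolding sum_divide_distrib[symmetric] sum.distrib 1 2 ..
    also have "\<dots> = of_real (r X)"
      by (simp add: complex_add_cnj W[symmetric] inner_mat s_def[symmetric])
    finally show "trace (X ** G) = of_real (r X)" .
  qed
qed

text \<open>Two-outcome observables built from \<open>outer a\<close> already determine the form of
  a matrix.\<close>

lemma eq_of_observables:
  fixes Z :: "complex^'n::finite^'n"
  assumes "\<And>As k. As \<in> observables \<Longrightarrow> k < length As \<Longrightarrow> trace ((As ! k) ** Y) = trace ((As ! k) ** Z)"
  shows "Y = Z"
proof -
  have "qf (Y - Z) v = 0" for v
  proof -
    \<comment> \<open>The factor shrinks \<open>v\<close> to squared norm at most 1, so that
      \<open>mat 1 - outer a\<close> is positive, and it stays nonzero, so that it cancels.\<close>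
    define c where "c = 1 / (1 + sqnorm v)"
    define a where "a = (\<lambda>i. of_real (sqrt c) * v i)"
    have c: "c > 0" "c * sqnorm v \<le> 1"
      using sqnorm_nonneg[of v] by (auto simp: c_def)
    have "sqnorm a = c * sqnorm v"
      using c by (simp add: a_def sqnorm_def norm_mult power_mult_distrib sum_distrib_left)
    then have "[outer a, mat 1 - outer a] \<in> observables"
      using c by (simp add: observables_def psd_outer psd_mat_1_minus trace_outer)
    from assms[OF this, of 0] have "qf Y a = qf Z a"
      by (simp add: trace_outer_mult)
    then have "c * qf Y v = c * qf Z v"
      using c(1) unfolding a_def qf_scale_vec by simp
    then show ?thesis using c(1) by (simp add: qf_diff)
  qed
  from qf_zeroD[OF this] show ?thesis by simp
qed

subsection \<open>Broadcast states are fixed by an entanglement breaking channel\<close>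

lemma broadcast_fixed_states:
  fixes L :: "complex^'n::finite^'n \<Rightarrow> complex^('n \<times> 'n)^('n \<times> 'n)"
  assumes ch: "channel L"
    and T: "\<And>\<rho>. \<rho> \<in> T \<Longrightarrow> \<rho> \<in> states \<and> ptrace1 (L \<rho>) = \<rho> \<and> ptrace2 (L \<rho>) = \<rho>"
  obtains \<Lambda> where "entanglement_breaking \<Lambda>" "T \<subseteq> Fix \<Lambda>"
proof -
  \<comment> \<open>A contraction is dominated by one marginal but has its trace read off from the
    other. Averaging over both factors makes the same map \<open>E\<close> govern both the bound
    \<open>R_le\<close> and the trace formula \<open>trR\<close>.\<close>
  define E where "E = (\<lambda>X. (1/2) *\<^sub>R (ptrace1 (L X) + ptrace2 (L X)))"
  define R where "R = (\<lambda>a X. (1/2) *\<^sub>R (contr1 a (L X) + contr2 a (L X)))"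
  note linL = channel_linear[OF ch]
  have linE: "linear E"
    unfolding E_def by (rule linearI)
      (simp_all add: linear_add[OF linL] linear_add[OF linear_contr(3)] linear_add[OF linear_contr(4)]
        linear_scale[OF linL] linear_scale[OF linear_contr(3)] linear_scale[OF linear_contr(4)] algebra_simps)
  have linR: "linear (R a)" for a
    unfolding R_def by (rule linearI)
      (simp_all add: linear_add[OF linL] linear_add[OF linear_contr(1)] linear_add[OF linear_contr(2)]
        linear_scale[OF linL] linear_scale[OF linear_contr(1)] linear_scale[OF linear_contr(2)] algebra_simps)
  have csL: "L (cscale c X) = cscale c (L X)" and trL: "trace (L X) = trace X" for c X
    using ch by (auto simp: channel_def)
  have csE: "E (cscale c X) = cscale c (E X)" for c X
    unfolding E_def csL cscale_ptrace linear_add[OF linear_cscale, symmetric]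
      linear_scale[OF linear_cscale, symmetric] ..
  have posE: "psd (E X)" if "psd X" for X
    unfolding E_def using channel_psd[OF ch that] by (auto intro!: psd_scaleR psd_add psd_ptrace1 psd_ptrace2)
  have trE: "trace (E X) = trace X" for X
    by (simp add: E_def trace_scaleR trace_add trace_ptrace1 trace_ptrace2 trL)
  have posR: "psd (R a X)" if "psd X" for a X
    unfolding R_def using channel_psd[OF ch that] by (auto intro!: psd_scaleR psd_add psd_contr1 psd_contr2)
  have R_le: "psd (sqnorm a *\<^sub>R E X - R a X)" if "psd X" for a X
  proof -
    have "sqnorm a *\<^sub>R E X - R a X = (1/2) *\<^sub>R
       ((sqnorm a *\<^sub>R ptrace1 (L X) - contr1 a (L X)) + (sqnorm a *\<^sub>R ptrace2 (L X) - contr2 a (L X)))"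
      by (simp add: E_def R_def algebra_simps)
    then show ?thesis
      using channel_psd[OF ch that] by (auto intro!: psd_scaleR psd_add contr1_le contr2_le)
  qed
  have trR: "trace (R a X) = qf (E X) a" for a X
    by (simp add: R_def E_def trace_scaleR trace_add trace_contr1 trace_contr2 qf_scaleR qf_add
        scaleR_conv_of_real[where 'a=complex])
  obtain P where linP: "linear P" and P: "\<And>X. E (P X) = P X" "\<And>X. E X = X \<Longrightarrow> P X = X"
    and posP: "\<And>X. psd X \<Longrightarrow> psd (P X)" and trP: "\<And>X. trace (P X) = trace X"
    using positive_projection[OF linE csE posE trE] by blast
  define \<Gamma> where "\<Gamma> = Fix E"
  define B where "B = {w. w extreme_point_of \<Gamma>}"
  have \<Gamma>: "\<Gamma> = states \<inter> {X. E X = X}" by (auto simp: \<Gamma>_def Fix_def)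
  have subE: "subspace {X. E X = X}"
    by (rule subspaceI) (simp_all add: linear_0[OF linE] linear_add[OF linE] linear_scale[OF linE])
  have "compact \<Gamma>" "convex \<Gamma>"
    unfolding \<Gamma> using compact_states convex_states closed_subspace[OF subE] subspace_imp_convex[OF subE]
    by (auto intro: compact_Int_closed convex_Int)
  then have hull: "\<Gamma> = convex hull B"
    unfolding B_def by (rule Krein_Milman_Minkowski)
  have B\<Gamma>: "B \<subseteq> \<Gamma>" by (auto simp: B_def extreme_point_of_def)
  have B1: "psd w" "trace w = 1" "E w = w" if "w \<in> B" for w
    using B\<Gamma> that by (auto simp: \<Gamma> states_def)
  have eig: "P (R a w) = Re (qf w a) *\<^sub>R w" if w: "w \<in> B" for a w
  proof -
    \<comment> \<open>As \<open>P\<close> fixes \<open>w = E w\<close> and preserves positivity, the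
      domination of \<open>R a w\<close> carries over to the fixed point
      \<open>P (R a w)\<close>.\<close>
    have "sqnorm a *\<^sub>R w - P (R a w) = P (sqnorm a *\<^sub>R E w - R a w)"
      using B1[OF w] P(2)[of w] by (simp add: linear_diff[OF linP] linear_scale[OF linP])
    then have "psd (sqnorm a *\<^sub>R w - P (R a w))"
      using posP[OF R_le[OF B1(1)[OF w], of a]] by (simp only: B1(3)[OF w])
    with w have "P (R a w) = Re (trace (P (R a w))) *\<^sub>R w"
      using posP posR B1[OF w] P(1)
      by (intro extreme_fixed_state[OF linE]) (auto simp: B_def \<Gamma>_def)
    then show ?thesis
      by (simp add: trP trR B1[OF w])
  qed
  have indB: "independent B"
  proof (rule independent_joint_eigenvectors)
    show "linear (\<lambda>X. P (R a X))" for a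
      using linear_compose[OF linR linP] by (simp add: o_def)
    show "P (R a w) = Re (qf w a) *\<^sub>R w" if "w \<in> B" for a w
      by (rule eig[OF that])
    \<comment> \<open>Distinct states have distinct forms, and the forms of positive matrices are
      real, so the eigenvalue families separate \<open>B\<close>.\<close>
    show "\<exists>a. Re (qf x a) \<noteq> Re (qf y a)" if "x \<in> B" "y \<in> B" "x \<noteq> y" for x y
    proof (rule ccontr)
      assume "\<not> ?thesis"
      then have "qf (x - y) a = 0" for a
        using B1(1)[OF that(1)] B1(1)[OF that(2)]
        by (simp add: qf_diff psd_iff complex_nonneg_Reals_iff complex_eq_iff)
      from qf_zeroD[OF this] that show False by simp
    qed
    have "trace (0 :: complex^'n^'n) \<noteq> 1" by (simp add: trace_def)
    then show "0 \<notin> B" using B1(2) by metis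
  qed
  then have finB: "finite B" by (rule independent_imp_finite)
  have "\<exists>r. linear r \<and> (\<forall>w\<in>B. r w = (if w = b then 1 else 0 :: real))" for b
    by (rule linear_independent_extend[OF indB])
  \<comment> \<open>The functionals dual to the independent set \<open>B\<close>: on the simplex of
    fixed states they are the barycentric coordinates.\<close>
  then obtain r where r: "\<And>b. linear (r b)" "\<And>b w. w \<in> B \<Longrightarrow> r b w = (if w = b then 1 else 0 :: real)"
    by metis
  \<comment> \<open>The functional is merely real-linear, so the matrix represents it on Hermitian
    arguments only.\<close>
  have "\<exists>G. \<forall>X. (\<forall>i j. X $ j $ i = cnj (X $ i $ j)) \<longrightarrow> trace (X ** G) = of_real (r b (P X))" for b
  proof -
    have "linear (\<lambda>X. r b (P X))"
      using linear_compose[OF linP r(1)] by (simp add: o_def)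
    from functional_matrix[OF this] show ?thesis by metis
  qed
  then obtain G where "\<And>b. \<forall>X. (\<forall>i j. X $ j $ i = cnj (X $ i $ j)) \<longrightarrow> trace (X ** G b) = of_real (r b (P X))"
    by metis
  then have G: "trace (X ** G b) = of_real (r b (P X))" if "psd X" for X b
    using psd_hermitian[OF that] by blast
  have coord: "(\<forall>b\<in>B. 0 \<le> r b \<rho>) \<and> (\<Sum>b\<in>B. r b \<rho>) = 1 \<and> (\<Sum>b\<in>B. r b \<rho> *\<^sub>R b) = \<rho>" if "\<rho> \<in> \<Gamma>" for \<rho>
  proof -
    obtain u where u: "\<forall>x\<in>B. 0 \<le> u x" "sum u B = 1" "(\<Sum>x\<in>B. u x *\<^sub>R x) = \<rho>"
      using \<open>\<rho> \<in> \<Gamma>\<close> unfolding hull convex_hull_finite[OF finB] by blast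
    have "r b \<rho> = u b" if "b \<in> B" for b
    proof -
      have "r b \<rho> = (\<Sum>x\<in>B. u x * r b x)"
        unfolding u(3)[symmetric] linear_sum[OF r(1)] linear_scale[OF r(1)] by simp
      also have "\<dots> = (\<Sum>x\<in>B. if x = b then u x else 0)"
        by (intro sum.cong refl) (simp add: r(2))
      finally show ?thesis using finB that by simp
    qed
    then show ?thesis using u by simp
  qed
  \<comment> \<open>Coordinates are known for fixed states, so a positive \<open>X\<close> is
    divided by its trace; trace 0 forces \<open>X = 0\<close>.\<close>
  have coordP: "(\<forall>b\<in>B. 0 \<le> r b (P X)) \<and> (\<Sum>b\<in>B. r b (P X)) = Re (trace X)" if X: "psd X" for X
  proof (cases "Re (trace X) = 0")
    case True
    then have "X = 0"
      using cmod_entry_le_trace[OF X] by (simp add: vec_eq_iff)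
    then show ?thesis
      using linear_0[OF linP] linear_0[OF r(1)] by (simp add: trace_def)
  next
    case False
    define t where "t = Re (trace X)"
    have t: "t > 0" "trace X = of_real t"
      using trace_nonneg[OF X] False by (auto simp: t_def complex_nonneg_Reals_iff complex_eq_iff)
    have "(1 / t) *\<^sub>R P X \<in> \<Gamma>"
      using t posP[OF X] P(1)[of X] by (simp add: \<Gamma> states_def psd_scaleR trace_scaleR trP linear_scale[OF linE])
    from coord[OF this] show ?thesis
      using t by (simp add: linear_scale[OF r(1)] sum_divide_distrib[symmetric] zero_le_divide_iff)
  qed
  \<comment> \<open>The form of \<open>G b\<close> at \<open>a\<close> is a coordinate of
    \<open>P (outer a)\<close>. Nonnegative coordinates thus give positivity, and their sum
    \<open>sqnorm a\<close> gives the resolution of the identity.\<close>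
  have qfG: "qf (G b) a = of_real (r b (P (outer a)))" for b a
    using G[OF psd_outer] by (simp add: trace_outer_mult)
  have "psd (G b)" if "b \<in> B" for b
    using that coordP[OF psd_outer] by (simp add: psd_iff qfG)
  moreover have sumG: "(\<Sum>b\<in>B. G b) = mat 1"
  proof -
    have "qf ((\<Sum>b\<in>B. G b) - mat 1) a = 0" for a
      using coordP[OF psd_outer, of a]
      by (simp add: qf_diff qf_sum qfG qf_mat_1 trace_outer flip: of_real_sum)
    from qf_zeroD[OF this] show ?thesis by simp
  qed
  obtain bs where bs: "set bs = B" "distinct bs"
    using finite_distinct_list[OF finB] by blast
  define \<Lambda> where "\<Lambda> = (\<lambda>\<rho>. sum_list (map2 (\<lambda>G \<sigma>. cscale (trace (\<rho> ** G)) \<sigma>) (map G bs) bs))"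
  have \<Lambda>: "\<Lambda> \<rho> = (\<Sum>b\<in>B. cscale (trace (\<rho> ** G b)) b)" for \<rho>
  proof -
    have "map2 (\<lambda>G \<sigma>. cscale (trace (\<rho> ** G)) \<sigma>) (map G bs) bs = map (\<lambda>b. cscale (trace (\<rho> ** G b)) b) bs"
      by (induction bs) auto
    then show ?thesis
      using sum_list_distinct_conv_sum_set[OF bs(2)] bs(1) by (simp add: \<Lambda>_def)
  qed
  have "map G bs \<in> observables"
    using bs \<open>\<And>b. b \<in> B \<Longrightarrow> psd (G b)\<close> sumG
    by (auto simp: observables_def sum_list_distinct_conv_sum_set)
  moreover have "set bs \<subseteq> states"
    using bs B1 by (auto simp: states_def)
  ultimately have "entanglement_breaking \<Lambda>"
    unfolding entanglement_breaking_def
    by (intro exI[of _ "map G bs"] exI[of _ bs]) (simp add: \<Lambda>_def)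
  moreover have "T \<subseteq> Fix \<Lambda>"
  proof
    fix \<rho> assume "\<rho> \<in> T"
    then have \<rho>: "\<rho> \<in> states" "E \<rho> = \<rho>"
      using T[of \<rho>] by (simp_all add: E_def flip: scaleR_2)
    then have "\<rho> \<in> \<Gamma>" by (simp add: \<Gamma>)
    have "\<Lambda> \<rho> = \<rho>"
      using coord[OF \<open>\<rho> \<in> \<Gamma>\<close>] \<rho> by (simp add: \<Lambda> G states_def P(2) cscale_of_real)
    with \<rho> show "\<rho> \<in> Fix \<Lambda>" by (simp add: Fix_def)
  qed
  ultimately show thesis using that by blast
qed

subsection \<open>Measure-and-prepare maps\<close>

lemma completely_positive_0: "completely_positive (\<lambda>_. 0)"
  by (simp add: completely_positive_def psd_on_def case_prod_unfold)

lemma completely_positive_add: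
  assumes "completely_positive F" "completely_positive H"
  shows "completely_positive (\<lambda>X. F X + H X)"
  unfolding completely_positive_def
proof (intro allI impI)
  fix k :: nat and X :: "('a \<times> nat) \<Rightarrow> ('a \<times> nat) \<Rightarrow> complex"
  assume "psd_on (UNIV \<times> {..<k}) X"
  with assms have
    "psd_on (UNIV \<times> {..<k}) (\<lambda>(p, a) (q, b). F (\<chi> i j. X (i, a) (j, b)) $ p $ q)"
    "psd_on (UNIV \<times> {..<k}) (\<lambda>(p, a) (q, b). H (\<chi> i j. X (i, a) (j, b)) $ p $ q)"
    unfolding completely_positive_def by blast+
  then show "psd_on (UNIV \<times> {..<k}) (\<lambda>(p, a) (q, b). (F (\<chi> i j. X (i, a) (j, b)) + H (\<chi> i j. X (i, a) (j, b))) $ p $ q)"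
    by (simp add: psd_on_def Let_def case_prod_unfold algebra_simps sum.distrib)
qed

lemma sum_pairs_swap:
  fixes F :: "'a \<times> 'b \<Rightarrow> 'a \<times> 'b \<Rightarrow> 'c::comm_monoid_add"
  shows "(\<Sum>x\<in>A \<times> K. \<Sum>y\<in>A \<times> K. F x y) = (\<Sum>a\<in>K. \<Sum>b\<in>K. \<Sum>i\<in>A. \<Sum>j\<in>A. F (i, a) (j, b))"
proof -
  have s: "(\<Sum>x\<in>A \<times> K. f x) = (\<Sum>a\<in>K. \<Sum>i\<in>A. f (i, a))" for f :: "'a \<times> 'b \<Rightarrow> 'c"
    by (subst sum.swap) (simp add: sum.cartesian_product)
  show ?thesis
    unfolding s by (intro sum.cong refl) (rule sum.swap)
qed

text \<open>A map with a single rank-one Kraus operator. The form of the output at \<open>v\<close>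
  is the form of \<open>X\<close> at the vector \<open>g i * w a\<close>, where \<open>w\<close>
  contracts \<open>v\<close> with \<open>s\<close>.\<close>

lemma completely_positive_outer:
  "completely_positive (\<lambda>X. cscale (trace (X ** outer g)) (outer s))"
  unfolding completely_positive_def
proof (intro allI impI)
  fix k :: nat and X :: "('a \<times> nat) \<Rightarrow> ('a \<times> nat) \<Rightarrow> complex"
  assume X: "psd_on (UNIV \<times> {..<k}) X"
  show "psd_on (UNIV \<times> {..<k}) (\<lambda>(p, a) (q, b). cscale (trace ((\<chi> i j. X (i, a) (j, b)) ** outer g)) (outer s) $ p $ q)"
    unfolding psd_on_def
  proof
    fix v :: "'b \<times> nat \<Rightarrow> complex"
    define w where "w = (\<lambda>a. \<Sum>p\<in>UNIV. cnj (s p) * v (p, a))"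
    have cw: "cnj (w a) = (\<Sum>p\<in>UNIV. cnj (v (p, a)) * s p)" for a
      by (simp add: w_def mult.commute)
    define Q where "Q = (\<lambda>a b. \<Sum>i\<in>UNIV. \<Sum>j\<in>UNIV. cnj (g i) * X (i, a) (j, b) * g j)"
    have tr: "trace ((\<chi> i j. X (i, a) (j, b)) ** outer g) = Q a b" for a b
      by (simp add: trace_mul_sym[of _ "outer g"] trace_outer_mult qf_def Q_def)
    have e: "(\<Sum>i\<in>UNIV. \<Sum>j\<in>UNIV. cnj (v (i, a)) * cscale (Q a b) (outer s) $ i $ j * v (j, b))
        = cnj (w a) * Q a b * w b" for a b
    proof -
      have "(\<Sum>i\<in>UNIV. \<Sum>j\<in>UNIV. cnj (v (i, a)) * cscale (Q a b) (outer s) $ i $ j * v (j, b))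
        = Q a b * (cnj (w a) * w b)"
        unfolding cw unfolding w_def sum_product unfolding sum_distrib_left
        by (intro sum.cong refl) (simp add: cscale_def outer_def mult_ac)
      then show ?thesis by (simp add: mult_ac)
    qed
    have "(\<Sum>x\<in>UNIV \<times> {..<k}. \<Sum>y\<in>UNIV \<times> {..<k}. cnj (v x) *
        (case x of (p, a) \<Rightarrow> \<lambda>(q, b). cscale (trace ((\<chi> i j. X (i, a) (j, b)) ** outer g)) (outer s) $ p $ q) y * v y)
      = (\<Sum>a<k. \<Sum>b<k. cnj (w a) * Q a b * w b)"
      unfolding sum_pairs_swap tr prod.case e ..
    also have "\<dots> = (\<Sum>x\<in>UNIV \<times> {..<k}. \<Sum>y\<in>UNIV \<times> {..<k}.
        cnj (case x of (i, a) \<Rightarrow> g i * w a) * X x y * (case y of (j, b) \<Rightarrow> g j * w b))"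
      unfolding sum_pairs_swap prod.case Q_def sum_distrib_left sum_distrib_right
      by (intro sum.cong refl) (simp add: mult_ac)
    finally show "let q = \<Sum>x\<in>UNIV \<times> {..<k}. \<Sum>y\<in>UNIV \<times> {..<k}. cnj (v x) *
        (case x of (p, a) \<Rightarrow> \<lambda>(q, b). cscale (trace ((\<chi> i j. X (i, a) (j, b)) ** outer g)) (outer s) $ p $ q) y * v y
      in Im q = 0 \<and> 0 \<le> Re q"
      using X[unfolded psd_on_def, rule_format, of "\<lambda>(i, a). g i * w a"] by simp
  qed
qed

lemma cscale_add: "cscale (c + d) M = cscale c M + cscale d M" "cscale c (M + N) = cscale c M + cscale c N"
  by (simp_all add: cscale_def vec_eq_iff algebra_simps)

lemma cscale_0: "cscale 0 M = 0" "cscale c 0 = 0"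
  by (simp_all add: cscale_def vec_eq_iff)

text \<open>The map is additive in \<open>G\<close> and in \<open>\<sigma>\<close>, so two nested
  applications of \<open>psd_induct\<close> reduce to the rank-one case.\<close>

lemma completely_positive_measure_prepare:
  assumes "psd G" "psd \<sigma>"
  shows "completely_positive (\<lambda>X. cscale (trace (X ** G)) \<sigma>)"
  using assms(1)
proof (induction rule: psd_induct)
  case zero
  show ?case by (simp add: trace_def cscale_0 completely_positive_0)
next
  case (add_outer A a)
  from assms(2) have "completely_positive (\<lambda>X. cscale (trace (X ** outer a)) \<sigma>)"
  proof (induction rule: psd_induct)
    case zero
    show ?case by (simp add: cscale_0 completely_positive_0)
  next
    case (add_outer B b)
    then show ?case
      by (simp add: cscale_add completely_positive_add completely_positive_outer)
  qed
  with add_outer show ?case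
    by (simp add: matrix_add_ldistrib trace_add cscale_add completely_positive_add)
qed

lemma completely_positive_sum:
  "(\<And>k. k \<in> K \<Longrightarrow> completely_positive (F k)) \<Longrightarrow> completely_positive (\<lambda>X. \<Sum>k\<in>K. F k X)"
  by (induction K rule: infinite_finite_induct) (auto simp: completely_positive_0 completely_positive_add)

section \<open>Kronecker products and the broadcasting channel\<close>

definition kron :: "complex^'a^'a \<Rightarrow> complex^'b^'b \<Rightarrow> complex^('a \<times> 'b)^('a \<times> 'b)" where
  "kron A B = (\<chi> p q. A $ fst p $ fst q * B $ snd p $ snd q)"

lemma kron_outer: "kron (outer a) (outer b) = outer (\<lambda>p. a (fst p) * b (snd p))"
  by (simp add: kron_def outer_def vec_eq_iff)

lemma kron_0: "kron 0 B = 0" "kron A 0 = 0"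
  by (simp_all add: kron_def vec_eq_iff)

text \<open>The product is additive in each factor, and the product of two rank-one matrices
  \<open>outer a\<close> and \<open>outer b\<close> is again of this form.\<close>

lemma psd_kron:
  assumes "psd A" "psd B"
  shows "psd (kron A B)"
  using assms(1)
proof (induction rule: psd_induct)
  case zero
  show ?case by (simp add: kron_0 psd_0)
next
  case (add_outer A a)
  from assms(2) have "psd (kron (outer a) B)"
  proof (induction rule: psd_induct)
    case zero
    show ?case by (simp add: kron_0 psd_0)
  next
    case (add_outer B b)
    have "kron (outer a) (B + outer b) = kron (outer a) B + kron (outer a) (outer b)"
      by (simp add: kron_def vec_eq_iff algebra_simps)
    with add_outer show ?case by (simp add: kron_outer psd_add psd_outer)
  qed
  moreover have "kron (A + outer a) B = kron A B + kron (outer a) B"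
    by (simp add: kron_def vec_eq_iff algebra_simps)
  ultimately show ?case using add_outer by (simp add: psd_add)
qed

lemma ptrace_kron: "ptrace2 (kron A B) = cscale (trace B) A" "ptrace1 (kron A B) = cscale (trace A) B"
  by (simp_all add: ptrace1_def ptrace2_def kron_def cscale_def trace_def vec_eq_iff
      sum_distrib_left sum_distrib_right mult.commute)

lemma trace_kron: "trace (kron A B) = trace A * trace B"
  using trace_ptrace2[of "kron A B"] by (simp add: ptrace_kron trace_cscale mult.commute)

lemma trace_sum: "trace (sum f K) = (\<Sum>k\<in>K. trace (f k))"
  unfolding trace_def sum_component by (rule sum.swap)

text \<open>The output dimension is left free because the states prepared later live on the tensor
  square. The trace is preserved since each \<open>\<tau> k\<close> has trace 1 and the
  \<open>G k\<close> sum to the identity.\<close>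

lemma channel_measure_prepare:
  fixes \<tau> :: "'k \<Rightarrow> complex^'b::finite^'b" and G :: "'k \<Rightarrow> complex^'a::finite^'a"
  assumes "finite K" "\<And>k. k \<in> K \<Longrightarrow> psd (G k)" "(\<Sum>k\<in>K. G k) = mat 1" "\<And>k. k \<in> K \<Longrightarrow> \<tau> k \<in> states"
  shows "channel (\<lambda>X. \<Sum>k\<in>K. cscale (trace (X ** G k)) (\<tau> k))"
  unfolding channel_def
proof (intro conjI allI)
  show "(\<Sum>k\<in>K. cscale (trace ((X + Y) ** G k)) (\<tau> k)) =
       (\<Sum>k\<in>K. cscale (trace (X ** G k)) (\<tau> k)) + (\<Sum>k\<in>K. cscale (trace (Y ** G k)) (\<tau> k))" for X Y
    by (simp add: trace_def matrix_matrix_mult_def algebra_simps sum.distrib cscale_add)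
  show "(\<Sum>k\<in>K. cscale (trace (cscale c X ** G k)) (\<tau> k)) = cscale c (\<Sum>k\<in>K. cscale (trace (X ** G k)) (\<tau> k))" for c X
  proof -
    have 1: "trace (cscale c X ** G k) = c * trace (X ** G k)" for k
      by (simp add: trace_def matrix_matrix_mult_def cscale_def sum_distrib_left mult_ac)
    have 2: "cscale (c * d) M = cscale c (cscale d M)" for d and M :: "complex^'b^'b"
      by (simp add: cscale_def vec_eq_iff mult.assoc)
    show ?thesis unfolding 1 2 linear_sum[OF linear_cscale] ..
  qed
  show "completely_positive (\<lambda>X. \<Sum>k\<in>K. cscale (trace (X ** G k)) (\<tau> k))"
  proof (rule completely_positive_sum)
    fix k assume "k \<in> K"
    with assms(2,4) show "completely_positive (\<lambda>X. cscale (trace (X ** G k)) (\<tau> k))"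
      by (intro completely_positive_measure_prepare) (auto simp: states_def)
  qed
  show "trace (\<Sum>k\<in>K. cscale (trace (X ** G k)) (\<tau> k)) = trace X" for X
  proof -
    have "trace (\<Sum>k\<in>K. cscale (trace (X ** G k)) (\<tau> k)) = (\<Sum>k\<in>K. trace (X ** G k))"
      unfolding trace_sum trace_cscale using assms(4) by (simp add: states_def)
    also have "\<dots> = trace (X ** (\<Sum>k\<in>K. G k))"
      using assms(1) by induction (simp_all add: trace_def matrix_add_ldistrib sum.distrib)
    finally show ?thesis by (simp add: assms(3))
  qed
qed

text \<open>A measurement outcome is classical and can be used twice; as the prepared states have
  trace 1, discarding either copy returns \<open>\<Lambda>\<close>.\<close>

lemma entanglement_breaking_broadcast:
  fixes \<Lambda> :: "complex^'n::finite^'n \<Rightarrow> complex^'n^'n"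
  assumes "entanglement_breaking \<Lambda>"
  obtains L :: "complex^'n^'n \<Rightarrow> complex^('n \<times> 'n)^('n \<times> 'n)"
  where "channel L" "\<And>X. ptrace1 (L X) = \<Lambda> X" "\<And>X. ptrace2 (L X) = \<Lambda> X"
proof -
  obtain Gs \<sigma>s where len: "length Gs = length \<sigma>s" and Gs: "Gs \<in> observables" and \<sigma>s: "set \<sigma>s \<subseteq> states"
    and \<Lambda>: "\<And>\<rho>. \<Lambda> \<rho> = sum_list (map2 (\<lambda>G \<sigma>. cscale (trace (\<rho> ** G)) \<sigma>) Gs \<sigma>s)"
    using assms unfolding entanglement_breaking_def by blast
  define K where "K = {0..<length Gs}"
  have st: "psd (\<sigma>s ! k)" "trace (\<sigma>s ! k) = 1" if "k \<in> K" for k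
    using subsetD[OF \<sigma>s nth_mem[of k]] that len by (simp_all add: K_def states_def)
  have sum: "\<Lambda> X = (\<Sum>k\<in>K. cscale (trace (X ** Gs ! k)) (\<sigma>s ! k))" for X
    by (simp add: \<Lambda> sum_list_sum_nth len K_def)
  define L where "L = (\<lambda>X. \<Sum>k\<in>K. cscale (trace (X ** Gs ! k)) (kron (\<sigma>s ! k) (\<sigma>s ! k)))"
  have "channel L"
    unfolding L_def
  proof (rule channel_measure_prepare)
    show "finite K" by (simp add: K_def)
    show "psd (Gs ! k)" if "k \<in> K" for k
      using Gs that by (simp add: observables_def K_def)
    show "(\<Sum>k\<in>K. Gs ! k) = mat 1"
      using Gs by (simp add: observables_def sum_list_sum_nth K_def)
    show "kron (\<sigma>s ! k) (\<sigma>s ! k) \<in> states" if "k \<in> K" for k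
      using st[OF that] by (simp add: states_def psd_kron trace_kron)
  qed
  moreover have "cscale 1 M = M" for M :: "complex^'n^'n"
    by (simp add: cscale_def)
  then have "ptrace1 (L X) = \<Lambda> X" "ptrace2 (L X) = \<Lambda> X" for X
    unfolding L_def sum linear_sum[OF linear_contr(3)] linear_sum[OF linear_contr(4)] cscale_ptrace ptrace_kron
    by (simp_all add: st)
  ultimately show thesis using that by blast
qed

theorem theorem1:
  fixes T :: "(complex^'n::finite^'n) set"
  assumes "T \<subseteq> states"
  shows "(\<exists>\<Lambda> :: complex^'n^'n \<Rightarrow> complex^'n^'n. entanglement_breaking \<Lambda> \<and> T \<subseteq> Fix \<Lambda>)
     \<longleftrightarrow> broadcastable T observables observables"
proof
  assume "\<exists>\<Lambda> :: complex^'n^'n \<Rightarrow> complex^'n^'n. entanglement_breaking \<Lambda> \<and> T \<subseteq> Fix \<Lambda>"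
  then obtain \<Lambda> :: "complex^'n^'n \<Rightarrow> complex^'n^'n"
    where \<Lambda>: "entanglement_breaking \<Lambda>" "T \<subseteq> Fix \<Lambda>" by blast
  obtain L :: "complex^'n^'n \<Rightarrow> complex^('n \<times> 'n)^('n \<times> 'n)"
    where L: "channel L" "\<And>X. ptrace1 (L X) = \<Lambda> X" "\<And>X. ptrace2 (L X) = \<Lambda> X"
    using entanglement_breaking_broadcast[OF \<Lambda>(1)] by blast
  have "\<Lambda> \<rho> = \<rho>" if "\<rho> \<in> T" for \<rho>
    using that \<Lambda>(2) by (auto simp: Fix_def)
  with L show "broadcastable T observables observables"
    unfolding broadcastable_def by (intro exI[of _ L]) simp
next
  assume "broadcastable T observables observables"
  then obtain L :: "complex^'n^'n \<Rightarrow> complex^('n \<times> 'n)^('n \<times> 'n)" where L: "channel L"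
    and tr2: "\<forall>As\<in>observables. \<forall>\<rho>\<in>T. \<forall>k<length As.
        trace ((As ! k) ** ptrace2 (L \<rho>)) = trace ((As ! k) ** \<rho>)"
    and tr1: "\<forall>Bs\<in>observables. \<forall>\<rho>\<in>T. \<forall>k<length Bs.
        trace ((Bs ! k) ** ptrace1 (L \<rho>)) = trace ((Bs ! k) ** \<rho>)"
    unfolding broadcastable_def by (elim exE conjE) (rule that)
  \<comment> \<open>Agreement of the statistics for all observables forces both marginals to equal
    the input state.\<close>
  have "\<rho> \<in> states \<and> ptrace1 (L \<rho>) = \<rho> \<and> ptrace2 (L \<rho>) = \<rho>" if "\<rho> \<in> T" for \<rho>
  proof (intro conjI)
    show "\<rho> \<in> states" using assms that by blast
    show "ptrace1 (L \<rho>) = \<rho>" by (rule eq_of_observables) (use tr1 that in simp)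
    show "ptrace2 (L \<rho>) = \<rho>" by (rule eq_of_observables) (use tr2 that in simp)
  qed
  with broadcast_fixed_states[OF L, of T]
  show "\<exists>\<Lambda> :: complex^'n^'n \<Rightarrow> complex^'n^'n. entanglement_breaking \<Lambda> \<and> T \<subseteq> Fix \<Lambda>"
    by blast
qed

end
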